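(* Let $n\ge 2$, $q_0=2^n$, $q=2q_0^2$, and let $X_n\subseteq\mathbb{P}^4$ and $g_n=q_0(q-1)$ be as in the context. For a positive integer $t$, let $\mathcal{K}(t,X_n)$ be the $\mathbb{F}$-vector space of homogeneous polynomials of degree $t$ in the five homogeneous coordinates of $\mathbb{P}^4$ vanishing on $X_n$, i.e. the kernel of the restriction map $H^0(\mathbb{P}^4,\mathcal{O}_{\mathbb{P}^4}(t))\to H^0(X_n,\mathcal{O}_{X_n}(t))$, and let $\kappa(t,X_n)=\dim_{\mathbb{F}}\mathcal{K}(t,X_n)$. Then $$\kappa(t,X_n)=\begin{cases}\binom{t+2}{4} & \text{if } 2\le t\le q_0,\\[2pt] \binom{t+4}{4}-t(q+2q_0+1)-1+g_n & \text{if } t\ge 2q_0+1.\end{cases}$$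
   Context: Let $n\ge 2$ be an integer, $q_0=2^n$, $q=2q_0^2$, and let $\mathbb{F}$ be any field containing $\mathbb{F}_q$. The Suzuki curve $S_n\subseteq\mathbb{P}^2$ is the plane curve over $\mathbb{F}$ with affine equation $y^q-y=x^{q_0}(x^q-x)$. It has a unique point at infinity $P_\infty=(0:1:0)$, which is its only singular point (a cusp). Let $\pi:C_n\to S_n$ be the normalization; $\pi$ is injective, and we write $P_\infty$ also for $\pi^{-1}(P_\infty)$. The genus of $C_n$ is $g_n=q_0(q-1)$. For an integer $m\ge0$, $L(mP_\infty)$ denotes the Riemann–Roch space of rational functions on $C_n$ with pole order at most $m$ at $P_\infty$ and no other poles. The space $L((q+2q_0+1)P_\infty)$ has dimension $5$ and the complete linear system $|(q+2q_0+1)P_\infty|$ is very ample; $X_n\subseteq\mathbb{P}^4$ denotes the image of $C_n$ under the embedding $C_n\to\mathbb{P}^4$ defined by this linear system (a smooth curve of degree $q+2q_0+1$), and $\mathcal{O}_{X_n}(t)$ is the restriction of $\mathcal{O}_{\mathbb{P}^4}(t)$ to $X_n$. *)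

theory Defs
  imports "HOL-Computational_Algebra.Polynomial" "HOL-Library.Function_Algebras"
begin

definition q0 :: "nat \<Rightarrow> nat" where "q0 n = 2 ^ n"
definition qq :: "nat \<Rightarrow> nat" where "qq n = 2 * (q0 n)^2"
definition genus :: "nat \<Rightarrow> nat" where "genus n = q0 n * (qq n - 1)"

text \<open>Bivariate polynomials over F are represented as 'a poly poly: the outer
  variable is y, the inner variable is x.  The Suzuki polynomial
  y^q - y - x^q0 (x^q - x).\<close>
definition suzuki_poly :: "nat \<Rightarrow> 'a::field poly poly" where
  "suzuki_poly n = monom 1 (qq n) - monom 1 1
      - [: monom 1 (q0 n + qq n) - monom 1 (q0 n + 1) :]"

definition X_fn :: "'a::field poly poly" where "X_fn = [: [:0, 1:] :]"

text \<open>Places of the function field K = Frac(F[x,y]/(f)) of C_n, given as normalized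
  discrete valuations of K trivial on F, described by their values on the
  classes of polynomials not divisible by f (v(g/h) = v g - v h).\<close>
definition is_place :: "nat \<Rightarrow> ('a::field poly poly \<Rightarrow> int) \<Rightarrow> bool" where
  "is_place n v \<longleftrightarrow> (let f = (suzuki_poly n :: 'a poly poly) in
     (\<forall>g h. \<not> f dvd g \<longrightarrow> \<not> f dvd h \<longrightarrow> v (g * h) = v g + v h) \<and>
     (\<forall>g g'. \<not> f dvd g \<longrightarrow> f dvd (g - g') \<longrightarrow> v g' = v g) \<and>
     (\<forall>g h. \<not> f dvd g \<longrightarrow> \<not> f dvd h \<longrightarrow> \<not> f dvd (g + h) \<longrightarrow>
            min (v g) (v h) \<le> v (g + h)) \<and>
     (\<forall>c. c \<noteq> 0 \<longrightarrow> v [:[:c:]:] = 0) \<and>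
     (\<exists>g h. \<not> f dvd g \<and> \<not> f dvd h \<and> v g - v h = 1))"

text \<open>Elements of K are pairs (g,h) (meaning g/h) with f not dividing h.\<close>
definition ff_zero :: "nat \<Rightarrow> 'a::field poly poly \<times> 'a poly poly \<Rightarrow> bool" where
  "ff_zero n u \<longleftrightarrow> suzuki_poly n dvd fst u"

definition ff_eq :: "nat \<Rightarrow> 'a::field poly poly \<times> 'a poly poly
      \<Rightarrow> 'a poly poly \<times> 'a poly poly \<Rightarrow> bool" where
  "ff_eq n u w \<longleftrightarrow> suzuki_poly n dvd (fst u * snd w - fst w * snd u)"

text \<open>Riemann-Roch space L(m P_inf): P_inf is the (unique) place at which x has a pole.\<close>
definition riemann_roch :: "nat \<Rightarrow> nat \<Rightarrow> ('a::field poly poly \<times> 'a poly poly) set" where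
  "riemann_roch n m = {(g, h). \<not> suzuki_poly n dvd h \<and>
      (suzuki_poly n dvd g \<or>
       (\<forall>v. is_place n v \<longrightarrow>
          (if v X_fn < 0 then - int m else 0) \<le> v g - v h))}"

definition lincomb :: "(nat \<Rightarrow> 'a::field) \<Rightarrow> (nat \<Rightarrow> 'a poly poly \<times> 'a poly poly)
      \<Rightarrow> 'a poly poly \<times> 'a poly poly" where
  "lincomb c \<phi> = ((\<Sum>i<5. [:[:c i:]:] * fst (\<phi> i) * (\<Prod>j\<in>{..<5}-{i}. snd (\<phi> j))),
                   (\<Prod>j<5. snd (\<phi> j)))"

definition emb_degree :: "nat \<Rightarrow> nat" where "emb_degree n = qq n + 2 * q0 n + 1"

text \<open>phi_0..phi_4 is an F-basis of L((q+2q0+1) P_inf); it defines the embedding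
  C_n -> P^4 with image X_n.\<close>
definition is_L_basis :: "nat \<Rightarrow> (nat \<Rightarrow> 'a::field poly poly \<times> 'a poly poly) \<Rightarrow> bool" where
  "is_L_basis n \<phi> \<longleftrightarrow>
     (\<forall>i<5. \<phi> i \<in> riemann_roch n (emb_degree n)) \<and>
     (\<forall>c. ff_zero n (lincomb c \<phi>) \<longrightarrow> (\<forall>i<5. c i = 0)) \<and>
     (\<forall>u \<in> riemann_roch n (emb_degree n). \<exists>c. ff_eq n u (lincomb c \<phi>))"

text \<open>Homogeneous polynomials of degree t in 5 variables: coefficient functions
  on exponent vectors (lists of length 5) of total degree t.\<close>
definition monoms :: "nat \<Rightarrow> nat list set" where
  "monoms t = {e. length e = 5 \<and> sum_list e = t}"

definition hom_polys :: "nat \<Rightarrow> (nat list \<Rightarrow> 'a::field) set" where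
  "hom_polys t = {P. \<forall>e. P e \<noteq> 0 \<longrightarrow> e \<in> monoms t}"

text \<open>P(phi_0,...,phi_4) * prod_i h_i^t, where phi_i = g_i / h_i.\<close>
definition eval_hom :: "(nat \<Rightarrow> 'a::field poly poly \<times> 'a poly poly) \<Rightarrow> nat
      \<Rightarrow> (nat list \<Rightarrow> 'a) \<Rightarrow> 'a poly poly" where
  "eval_hom \<phi> t P = (\<Sum>e\<in>monoms t. [:[:P e:]:] *
      (\<Prod>i<5. fst (\<phi> i) ^ (e ! i) * snd (\<phi> i) ^ (t - e ! i)))"

text \<open>K(t, X_n): degree-t forms vanishing on X_n, i.e. P(phi) = 0 in K.\<close>
definition vanishing_forms :: "nat \<Rightarrow> (nat \<Rightarrow> 'a::field poly poly \<times> 'a poly poly)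
      \<Rightarrow> nat \<Rightarrow> (nat list \<Rightarrow> 'a) set" where
  "vanishing_forms n \<phi> t = {P \<in> hom_polys t. suzuki_poly n dvd eval_hom \<phi> t P}"

definition kappa :: "nat \<Rightarrow> (nat \<Rightarrow> 'a::field poly poly \<times> 'a poly poly) \<Rightarrow> nat \<Rightarrow> nat" where
  "kappa n \<phi> t = vector_space.dim (\<lambda>(a::'a) P. \<lambda>e. a * P e) (vanishing_forms n \<phi> t)"

end

theory Submission
  imports Defs "HOL-Computational_Algebra.Formal_Laurent_Series" "HOL-Library.Set_Algebras"
begin

text \<open>
  The branch of the curve at infinity embeds the coordinate ring \<open>F[x,y]/(f)\<close> into a field of
  formal Laurent series, and \<open>z = x\<^bsup>2q0+1\<^esup> + y\<^bsup>2q0\<^esup>\<close>, \<open>w = y\<^sup>2 + x z\<close> satisfy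
  \<open>z\<^bsup>q0\<^esup> = y + x\<^bsup>q0+1\<^esup>\<close> and \<open>w\<^bsup>q0\<^esup> = z + x\<^bsup>q0\<^esup> y\<close> modulo \<open>f\<close>. These relations reduce every polynomial
  to a combination of the monomials \<open>x\<^bsup>i\<^esup> y\<^bsup>a\<^esup> z\<^bsup>b\<^esup> w\<^bsup>c\<^esup>\<close> with \<open>a < 2\<close> and \<open>b, c < q0\<close>, whose pole
  orders are pairwise distinct; hence evaluation at the branch has kernel \<open>(f)\<close>, and the pole orders
  of functions regular outside infinity form an explicit numerical semigroup.

  Every place at which \<open>x\<close> has a pole is minus the pole order, so \<open>1, x, y, z, w\<close> lie in
  \<open>L((q + 2 q0 + 1) P)\<close>. They are independent and lie in the span of the five functions of any
  basis, so that span is theirs. By rank-nullity it remains to find the dimension of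
  the space spanned by the monomials of degree at most \<open>t\<close> in \<open>x, y, z, w\<close>, that is, to
  count the pole orders occurring in it. For \<open>t \<le> q0\<close> the monomials with exponent of \<open>y\<close> at most
  \<open>1\<close> span and have distinct pole orders. In general a pole order \<open>s \<le> t (q + 2 q0 + 1)\<close> is
  attained in degree at most \<open>t\<close>, since a monomial of too large degree can be exchanged for one
  with the same pole order; for \<open>t \<ge> 2 q0 + 1\<close> these are counted by the symmetry \<open>s \<mapsto> 2g - 1 - s\<close> of the semigroup.
\<close>

section \<open>Linear algebra over Laurent series\<close>

text \<open>The expansion of \<open>x\<close> over \<open>B \<union> C\<close> is unique, so its
  support lies in both \<open>B\<close> and \<open>C\<close> and is empty.\<close>

lemma (in vector_space) span_Int_span_independent:
  assumes "independent (B \<union> C)" "B \<inter> C = {}" "x \<in> span B" "x \<in> span C"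
  shows "x = 0"
proof -
  have "representation (B \<union> C) x = representation B x"
    by (rule representation_extend) (use assms in auto)
  moreover have "representation (B \<union> C) x = representation C x"
    by (rule representation_extend) (use assms in auto)
  ultimately have "representation (B \<union> C) x b = 0" for b
    by (metis assms(2) disjoint_iff representation_ne_zero)
  moreover have "x \<in> span (B \<union> C)"
    using assms(3) span_mono[of B "B \<union> C"] by blast
  ultimately show ?thesis
    using sum_nonzero_representation_eq[OF assms(1), of x] by simp
qed

text \<open>A basis \<open>B\<close> of the kernel extends to a basis \<open>C\<close> of
  \<open>V\<close>, and \<open>f\<close> carries \<open>C - B\<close> injectively to a basis of the
  image. The ambient space may be infinite-dimensional, as for coefficient functions on lists;
  \<open>S\<close> makes \<open>V\<close> finite-dimensional.\<close>

lemma (in vector_space_pair) dim_image_plus_dim_kernel: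
  assumes f: "Vector_Spaces.linear s1 s2 f" and V: "vs1.subspace V" and S: "finite S" "V \<subseteq> vs1.span S"
  shows "vs2.dim (f ` V) + vs1.dim {x \<in> V. f x = 0} = vs1.dim V"
proof -
  define K where "K = {x \<in> V. f x = 0}"
  obtain B where B: "B \<subseteq> K" "vs1.independent B" "K \<subseteq> vs1.span B"
    by (rule vs1.maximal_independent_subset)
  have KV: "K \<subseteq> V" by (auto simp: K_def)
  obtain C where C: "B \<subseteq> C" "C \<subseteq> V" "vs1.independent C" "V \<subseteq> vs1.span C"
    by (rule vs1.maximal_independent_subset_extend[of B V]) (use B KV in auto)
  have finC: "finite C"
    using vs1.independent_span_bound[OF S(1) C(3)] C(2) S(2) by auto
  have inj: "inj_on f (vs1.span (C - B))"
  proof -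
    have "x = 0" if x: "x \<in> vs1.span (C - B)" "f x = 0" for x
    proof (rule vs1.span_Int_span_independent)
      have "x \<in> V"
        using x(1) C(2) V vs1.span_minimal[of "C - B" V] by auto
      thus "x \<in> vs1.span B"
        using x(2) B(3) by (auto simp: K_def)
      show "vs1.independent (B \<union> (C - B))"
        using C(1,3) by (simp add: Un_absorb1)
    qed (use x in auto)
    thus ?thesis
      using linear_inj_on_iff_eq_0[OF f vs1.subspace_span] by blast
  qed
  have indep: "vs2.independent (f ` (C - B))"
    by (rule linear_independent_injective_image[OF f _ inj])
       (rule vs1.independent_mono[OF C(3)], auto)
  have f0: "f b = 0" if "b \<in> B" for b
    using that B(1) by (auto simp: K_def)
  have "f ` V \<subseteq> vs2.span (f ` C)"
    using C(4) linear_span_image[OF f, of C] by auto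
  also have "f ` C \<subseteq> insert 0 (f ` (C - B))"
    using f0 by auto
  hence "vs2.span (f ` C) \<subseteq> vs2.span (f ` (C - B))"
    by (metis vs2.span_insert_0 vs2.span_mono)
  finally have "f ` V \<subseteq> vs2.span (f ` (C - B))" .
  hence "card (f ` (C - B)) = vs2.dim (f ` V)"
    using C(2) indep by (intro vs2.basis_card_eq_dim) auto
  moreover have "card (f ` (C - B)) = card (C - B)"
    by (rule card_image, rule inj_on_subset[OF inj vs1.span_superset])
  moreover have "card B = vs1.dim K"
    by (rule vs1.basis_card_eq_dim[OF B(1,3,2)])
  moreover have "card C = vs1.dim V"
    by (rule vs1.basis_card_eq_dim[OF C(2,4,3)])
  moreover have "card (C - B) + card B = card C"
    using C(1) finC by (metis card_Diff_subset card_mono finite_subset le_add_diff_inverse2)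
  ultimately show ?thesis
    unfolding K_def by simp
qed

section \<open>Laurent series as a vector space filtered by the subdegree\<close>

global_interpretation fls: vector_space "\<lambda>(c::'a::field) u. fls_const c * u"
  by unfold_locales (simp_all add: distrib_left distrib_right flip: mult.assoc fls_plus_const)

lemma fls_subdegree_scale:
  "c \<noteq> 0 \<Longrightarrow> fls_subdegree (fls_const c * u) = fls_subdegree (u :: 'a::field fls)"
  by (cases "u = 0") auto

text \<open>Among terms of pairwise different order the one of lowest order cannot cancel, so it
  determines the order of the sum.\<close>

lemma fls_sum_distinct_subdegree:
  fixes u :: "'i \<Rightarrow> 'a::field fls"
  assumes "finite A" "A \<noteq> {}" "\<And>a. a \<in> A \<Longrightarrow> u a \<noteq> 0" "inj_on (\<lambda>a. fls_subdegree (u a)) A"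
  shows "sum u A \<noteq> 0 \<and> fls_subdegree (sum u A) \<in> (\<lambda>a. fls_subdegree (u a)) ` A"
  using assms
proof (induction A rule: finite_ne_induct)
  case (insert a A)
  have IH: "sum u A \<noteq> 0" "fls_subdegree (sum u A) \<in> (\<lambda>a. fls_subdegree (u a)) ` A"
    using insert by auto
  have ne: "fls_subdegree (u a) \<noteq> fls_subdegree (sum u A)"
    using IH(2) insert.prems(2) insert.hyps by auto
  hence "u a \<noteq> - sum u A" by auto
  hence "u a + sum u A \<noteq> 0" by (metis add_eq_0_iff2)
  moreover have "fls_subdegree (u a + sum u A) \<in> {fls_subdegree (u a), fls_subdegree (sum u A)}"
    using ne IH(1) insert.prems(1)[of a] fls_subdegree_add_eq1[of "u a" "sum u A"]
      fls_subdegree_add_eq2[of "sum u A" "u a"] by (cases "fls_subdegree (u a) < fls_subdegree (sum u A)") auto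
  ultimately show ?case
    using IH(2) insert.hyps by auto
qed auto

lemma fls_independent_distinct_subdegree:
  fixes A :: "'a::field fls set"
  assumes "0 \<notin> A" "inj_on fls_subdegree A"
  shows "fls.independent A"
  unfolding fls.independent_explicit_module
proof (intro allI impI, rule ccontr)
  fix T and u :: "'a fls \<Rightarrow> 'a" and v
  assume T: "finite T" "T \<subseteq> A" "(\<Sum>v\<in>T. fls_const (u v) * v) = 0" "v \<in> T" "u v \<noteq> 0"
  \<comment> \<open>Scaling preserves the subdegree only for nonzero scalars, so vanishing
    coefficients are dropped first.\<close>
  define T' where "T' = {v \<in> T. u v \<noteq> 0}"
  have "(\<Sum>v\<in>T'. fls_const (u v) * v) = (\<Sum>v\<in>T. fls_const (u v) * v)"
    using T(1) by (intro sum.mono_neutral_left) (auto simp: T'_def)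
  moreover have "inj_on (\<lambda>v. fls_subdegree (fls_const (u v) * v)) T' \<longleftrightarrow> inj_on fls_subdegree T'"
    by (rule inj_on_cong) (auto simp: T'_def fls_subdegree_scale)
  moreover have "inj_on fls_subdegree T'"
    using assms(2) T(2) by (auto simp: T'_def inj_on_def)
  ultimately show False
    using fls_sum_distinct_subdegree[of T' "\<lambda>v. fls_const (u v) * v"] T assms(1)
    by (auto simp: T'_def)
qed

text \<open>Cancelling the leading coefficients either exhausts \<open>u\<close> or raises the
  order. This step drives two later inductions: the dimension formula and the comparison of a place
  with the subdegree.\<close>

lemma fls_subdegree_sub_scale:
  fixes u v :: "'a::field fls"
  assumes "u \<noteq> 0" "v \<noteq> 0" "fls_subdegree u = fls_subdegree v"
  obtains c where "c \<noteq> 0" "u = fls_const c * v \<or>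
    u - fls_const c * v \<noteq> 0 \<and> fls_subdegree (u - fls_const c * v) > fls_subdegree v"
proof -
  define d where "d = fls_subdegree v"
  define c where "c = fls_nth u d / fls_nth v d"
  have nz: "fls_nth u d \<noteq> 0" "fls_nth v d \<noteq> 0"
    using assms nth_fls_subdegree_nonzero[of u] nth_fls_subdegree_nonzero[of v]
    by (auto simp: d_def)
  have "fls_nth (u - fls_const c * v) k = 0" if "k \<le> d" for k
    using that nz assms(3) by (cases "k = d") (auto simp: c_def d_def)
  hence "u \<noteq> fls_const c * v \<Longrightarrow> fls_subdegree (u - fls_const c * v) > d"
    by (intro fls_subdegree_greaterI) auto
  thus ?thesis
    using that[of c] nz by (auto simp: c_def d_def)
qed

text \<open>One vector chosen for each occurring order gives an echelon basis: distinct orders make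
  it independent, and repeated cancellation of leading terms shows that it spans.\<close>

lemma fls_dim_eq_card_subdegree:
  fixes U :: "'a::field fls set"
  assumes U: "fls.subspace U" and fin: "finite (fls_subdegree ` (U - {0}))"
  shows "fls.dim U = card (fls_subdegree ` (U - {0}))"
proof -
  define D where "D = fls_subdegree ` (U - {0})"
  have "\<forall>d\<in>D. \<exists>v. v \<in> U - {0} \<and> fls_subdegree v = d"
    by (auto simp: D_def)
  then obtain m where m: "\<And>d. d \<in> D \<Longrightarrow> m d \<in> U - {0} \<and> fls_subdegree (m d) = d"
    unfolding bchoice_iff by blast
  have inj: "inj_on m D" using m by (metis inj_onI)
  have ind: "fls.independent (m ` D)"
    using m by (intro fls_independent_distinct_subdegree) (auto simp: inj_on_def)
  have "u \<in> fls.span (m ` D)" if "u \<in> U" for u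
    using that
  \<comment> \<open>The order of the remainder rises strictly and cannot pass \<open>Max D\<close>,
    as only finitely many orders occur.\<close>
  proof (induction "nat (Max D - fls_subdegree u)" arbitrary: u rule: less_induct)
    case less
    show ?case
    proof (cases "u = 0")
      case False
      hence d: "fls_subdegree u \<in> D"
        using less.prems by (auto simp: D_def)
      define v where "v = m (fls_subdegree u)"
      have v: "v \<in> U" "v \<noteq> 0" "fls_subdegree u = fls_subdegree v" "v \<in> fls.span (m ` D)"
        using m[OF d] d by (auto simp: v_def intro: fls.span_base)
      obtain c where c: "c \<noteq> 0" "u = fls_const c * v \<or>
        u - fls_const c * v \<noteq> 0 \<and> fls_subdegree (u - fls_const c * v) > fls_subdegree v"
        by (rule fls_subdegree_sub_scale[OF False v(2,3)])
      have w: "u - fls_const c * v \<in> U"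
        using U v(1) less.prems by (intro fls.subspace_diff fls.subspace_scale)
      have "u - fls_const c * v \<in> fls.span (m ` D)"
      proof (cases "u - fls_const c * v = 0")
        case nz: False
        hence "fls_subdegree (u - fls_const c * v) \<le> Max D"
          using w fin by (intro Max_ge) (auto simp: D_def)
        thus ?thesis
          using c(2) nz v(3) w by (intro less.hyps) auto
      qed (simp only: fls.span_zero)
      hence "(u - fls_const c * v) + fls_const c * v \<in> fls.span (m ` D)"
        by (intro fls.span_add fls.span_scale v(4))
      thus ?thesis by simp
    qed (simp add: fls.span_zero)
  qed
  hence "card (m ` D) = fls.dim U"
    using m ind by (intro fls.basis_card_eq_dim) auto
  thus ?thesis
    using card_image[OF inj] by (simp add: D_def)
qed

section \<open>The semigroup of pole orders\<close>

text \<open>Pole order at infinity of x^i y^a z^b w^c. The exponents are integers because the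
  symmetry of the semigroup uses negative ones.\<close>

definition mon_wt :: "nat \<Rightarrow> int \<Rightarrow> int \<Rightarrow> int \<Rightarrow> int \<Rightarrow> int" where
  "mon_wt n i a b c = i * int (qq n) + a * int (qq n + q0 n) + b * int (qq n + 2 * q0 n)
     + c * int (qq n + 2 * q0 n + 1)"

text \<open>With these bounds each element arises from exactly one exponent vector. It is the
  Weierstrass semigroup at infinity: monomials attain these orders, and \<open>ev_pole\<close> shows
  that there are no others.\<close>

definition pole_semigroup :: "nat \<Rightarrow> int set" where
  "pole_semigroup n = {mon_wt n (int i) (int a) (int b) (int c) | i a b c. a < 2 \<and> b < q0 n \<and> c < q0 n}"

lemma mult_add_unique:
  fixes D :: int
  assumes "x * D + y = x' * D + y'" "y \<in> {0..<D}" "y' \<in> {0..<D}"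
  shows "x = x'" "y = y'"
proof -
  have "y = (x * D + y) mod D" "y' = (x' * D + y') mod D"
    using assms(2,3) by simp_all
  thus "y = y'" using assms(1) by simp
  thus "x = x'" using assms by simp
qed

lemma q0_pos: "q0 n > 0"
  by (simp add: q0_def)

lemma qq_eq: "int (qq n) = 2 * int (q0 n) * int (q0 n)"
  by (simp add: qq_def power2_eq_square)

text \<open>A mixed-radix expansion: \<open>c\<close> is the remainder modulo \<open>q0\<close>;
  once \<open>2 * c\<close> is removed from the quotient, \<open>a + 2 * b\<close> is the remainder
  modulo \<open>2 * q0\<close>.\<close>

lemma mon_wt_alt:
  "mon_wt n i a b c =
     (2 * int (q0 n) * (i + a + b + c) + (a + 2 * b) + 2 * c) * int (q0 n) + c"
  unfolding mon_wt_def by (simp add: qq_eq algebra_simps)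

text \<open>The reflected exponents and the original ones add up to (-1, 1, q0 - 1, q0 - 1), a
  vector of weight 2g - 1.\<close>

lemma mon_wt_complement:
  "mon_wt n (- 1 - i) (1 - a) (int (q0 n) - 1 - b) (int (q0 n) - 1 - c)
     = 2 * int (genus n) - 1 - mon_wt n i a b c"
proof -
  have "int (genus n) = int (q0 n) * (2 * int (q0 n) * int (q0 n) - 1)"
    using q0_pos[of n] by (simp add: genus_def qq_def power2_eq_square of_nat_diff)
  thus ?thesis
    unfolding mon_wt_def by (simp add: qq_eq algebra_simps)
qed

lemma mon_wt_reduced_unique:
  assumes eq: "mon_wt n i a b c = mon_wt n i' a' b' c'"
    and "a \<in> {0..<2}" "b \<in> {0..<int (q0 n)}" "c \<in> {0..<int (q0 n)}"
    and "a' \<in> {0..<2}" "b' \<in> {0..<int (q0 n)}" "c' \<in> {0..<int (q0 n)}"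
  shows "i = i' \<and> a = a' \<and> b = b' \<and> c = c'"
proof -
  define r where "r = int (q0 n)"
  have r: "r > 0" using q0_pos by (simp add: r_def)
  let ?k = "\<lambda>i a b c. 2 * r * (i + a + b + c) + (a + 2 * b) + 2 * c"
  have eq': "?k i a b c * r + c = ?k i' a' b' c' * r + c'"
    using eq by (simp add: mon_wt_alt r_def)
  have "(?k i a b c * r + c) mod r = c" "(?k i' a' b' c' * r + c') mod r = c'"
    using assms r by (auto simp: r_def)
  hence c: "c = c'" using eq' by simp
  with eq' r have "?k i a b c = ?k i' a' b' c'" by simp
  hence eq'': "(i + a + b + c) * (2 * r) + (a + 2 * b) = (i' + a' + b' + c') * (2 * r) + (a' + 2 * b')"
    using c by (simp add: mult.commute)
  have "((i + a + b + c) * (2 * r) + (a + 2 * b)) mod (2 * r) = a + 2 * b"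
       "((i' + a' + b' + c') * (2 * r) + (a' + 2 * b')) mod (2 * r) = a' + 2 * b'"
    using assms r by (auto simp: r_def)
  hence ab: "a + 2 * b = a' + 2 * b'" using eq'' by simp
  hence "a = a'" "b = b'" using assms by auto presburger+
  moreover have "i + a + b + c = i' + a' + b' + c'"
    using eq'' ab r by simp
  ultimately show ?thesis using c by simp
qed

text \<open>The digits of \<open>mon_wt_alt\<close> are read off in turn, and \<open>i\<close>
  absorbs what is left; it may be negative.\<close>

lemma mon_wt_reduced_exists:
  obtains i a b c where "m = mon_wt n i a b c"
    "a \<in> {0..<2}" "b \<in> {0..<int (q0 n)}" "c \<in> {0..<int (q0 n)}"
proof -
  define r where "r = int (q0 n)"
  have r: "r > 0" using q0_pos by (simp add: r_def)
  define c where "c = m mod r"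
  define k where "k = m div r - 2 * c"
  define l where "l = k mod (2 * r)"
  define a b where "a = l mod 2" and "b = l div 2"
  define i where "i = k div (2 * r) - a - b - c"
  have l: "0 \<le> l" "l < 2 * r" using r by (auto simp: l_def)
  have "m = (k + 2 * c) * r + c"
    by (simp add: k_def c_def)
  also have "k = k div (2 * r) * (2 * r) + l"
    unfolding l_def by (rule div_mult_mod_eq[symmetric])
  also have "k div (2 * r) = i + a + b + c" by (simp add: i_def)
  also have "l = a + 2 * b" by (simp add: a_def b_def)
  finally have "m = mon_wt n i a b c"
    by (simp add: mon_wt_alt r_def mult_ac)
  moreover have "a \<in> {0..<2}" "b \<in> {0..<int (q0 n)}" "c \<in> {0..<int (q0 n)}"
    using l r by (auto simp: a_def b_def c_def r_def)
  ultimately show ?thesis using that by blast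
qed

text \<open>Every integer has exactly one reduced exponent vector with integral \<open>i\<close>, so
  membership comes down to the sign of \<open>i\<close>.\<close>

lemma mon_wt_in_pole_semigroup_iff:
  assumes "a \<in> {0..<2}" "b \<in> {0..<int (q0 n)}" "c \<in> {0..<int (q0 n)}"
  shows "mon_wt n i a b c \<in> pole_semigroup n \<longleftrightarrow> i \<ge> 0"
proof
  assume "mon_wt n i a b c \<in> pole_semigroup n"
  then obtain i' a' b' c' where
    "mon_wt n i a b c = mon_wt n (int i') (int a') (int b') (int c')"
    "a' < 2" "b' < q0 n" "c' < q0 n"
    unfolding pole_semigroup_def by blast
  with mon_wt_reduced_unique[of n i a b c "int i'" "int a'" "int b'" "int c'"] assms
  show "i \<ge> 0" by auto
next
  assume "i \<ge> 0"
  thus "mon_wt n i a b c \<in> pole_semigroup n"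
    unfolding pole_semigroup_def mem_Collect_eq using assms
    by (intro exI[of _ "nat i"] exI[of _ "nat a"] exI[of _ "nat b"] exI[of _ "nat c"]) auto
qed

text \<open>Reflection keeps the bounds on \<open>a\<close>, \<open>b\<close>, \<open>c\<close> and
  replaces \<open>i\<close> by \<open>- 1 - i\<close>, which reverses the sign condition.\<close>

lemma pole_semigroup_symmetric:
  "2 * int (genus n) - 1 - m \<in> pole_semigroup n \<longleftrightarrow> m \<notin> pole_semigroup n"
proof -
  obtain i a b c where m: "m = mon_wt n i a b c"
    "a \<in> {0..<2}" "b \<in> {0..<int (q0 n)}" "c \<in> {0..<int (q0 n)}"
    by (rule mon_wt_reduced_exists)
  have "2 * int (genus n) - 1 - m \<in> pole_semigroup n \<longleftrightarrow> - 1 - i \<ge> 0"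
    unfolding m(1) mon_wt_complement[symmetric] using m(2-4)
    by (intro mon_wt_in_pole_semigroup_iff) auto
  also have "\<dots> \<longleftrightarrow> m \<notin> pole_semigroup n"
    unfolding m(1) mon_wt_in_pole_semigroup_iff[OF m(2-4)] by linarith
  finally show ?thesis .
qed

lemma pole_semigroup_nonneg: "m \<in> pole_semigroup n \<Longrightarrow> m \<ge> 0"
  unfolding pole_semigroup_def mon_wt_def by (elim CollectE exE conjE) (simp del: of_nat_add)

text \<open>Reflection pairs elements with gaps among 0, ..., 2g - 1, so exactly g of these 2g
  numbers are elements. Beyond 2g - 1 the reflected number is negative, hence no element, and so
  nothing is missing there.\<close>

lemma card_pole_semigroup_atMost:
  assumes M: "M \<ge> 2 * int (genus n) - 1"
  shows "int (card (pole_semigroup n \<inter> {..M})) = M + 1 - int (genus n)"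
proof -
  define g where "g = int (genus n)"
  define S where "S = pole_semigroup n"
  have sym: "2 * g - 1 - m \<in> S \<longleftrightarrow> m \<notin> S" for m
    unfolding g_def S_def by (rule pole_semigroup_symmetric)
  have nonneg: "m \<in> S \<Longrightarrow> m \<ge> 0" for m
    using pole_semigroup_nonneg by (auto simp: S_def)
  have "bij_betw (\<lambda>m. 2 * g - 1 - m) (S \<inter> {0..2*g-1}) ({0..2*g-1} - S)"
    by (rule bij_betwI[where g = "\<lambda>m. 2 * g - 1 - m"]) (auto simp: sym)
  hence "card (S \<inter> {0..2*g-1}) = card ({0..2*g-1} - S)"
    by (rule bij_betw_same_card)
  moreover have "card (S \<inter> {0..2*g-1}) + card ({0..2*g-1} - S) = card {0..2*g-1}"
    using card_Int_Diff[of "{0..2*g-1}" S] by (simp add: Int_commute)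
  moreover have "card {0..2*g-1} = nat (2 * g)" by simp
  ultimately have 1: "int (card (S \<inter> {0..2*g-1})) = g"
    by (simp add: g_def)
  have big: "m \<in> S" if "m \<ge> 2 * g" for m
    using sym[of m] nonneg[of "2 * g - 1 - m"] that by auto
  have "S \<inter> {..M} = (S \<inter> {0..2*g-1}) \<union> {2*g..M}"
    using M big nonneg by (auto simp: g_def)
  hence "card (S \<inter> {..M}) = card (S \<inter> {0..2*g-1}) + card {2*g..M}"
    by (simp add: card_Un_disjoint disjoint_iff)
  thus ?thesis
    using 1 M by (simp add: g_def S_def)
qed

text \<open>The exchanges are the leading-term versions of the relations \<open>y\<^sup>2 = x z + w\<close>,
  \<open>z\<^bsup>q0\<^esup> = y + x\<^bsup>q0+1\<^esup>\<close>, \<open>w\<^bsup>q0\<^esup> = z + x\<^bsup>q0\<^esup> y\<close> and \<open>y w\<^bsup>q0\<^esup> = x\<^bsup>q0\<^esup> w + z\<^bsup>q0+1\<^esup>\<close>. When none of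
  them applies, the weight exceeds \<open>d - 1\<close> times the embedding degree, \<open>d\<close> the degree of the monomial.\<close>

lemma mon_wt_low_degree:
  assumes "mon_wt n (int i) (int a) (int b) (int c) \<le> int t * int (emb_degree n)"
  shows "\<exists>i' a' b' c'. i' + a' + b' + c' \<le> t \<and>
    mon_wt n (int i') (int a') (int b') (int c') = mon_wt n (int i) (int a) (int b) (int c)"
  using assms
\<comment> \<open>The degree gets weight \<open>q0 + 1\<close> because trading x^(q0+1) for z^q0
  lowers it by one while raising \<open>b\<close> by \<open>q0\<close>. The exchanges that keep the
  degree lower \<open>a + b\<close>.\<close>
proof (induction "(q0 n + 1) * (i + a + b + c) + a + b" arbitrary: i a b c rule: less_induct)
  case less
  note IH = less.hyps
  define r where "r = q0 n"
  have r: "r > 0" using q0_pos by (simp add: r_def)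
  have wt: "mon_wt n i a b c =
     (2 * int r * (i + a + b + c) + (a + 2 * b) + 2 * c) * int r + c"
    for i a b c by (simp add: mon_wt_alt r_def)
  have step: ?case
    if "(r + 1) * (i' + a' + b' + c') + a' + b' < (r + 1) * (i + a + b + c) + a + b"
       "mon_wt n (int i') (int a') (int b') (int c') = mon_wt n (int i) (int a) (int b) (int c)"
     for i' a' b' c'
    using IH[of i' a' b' c'] that less.prems by (simp add: r_def)
  consider (a) "a \<ge> 2" | (i) "i \<ge> r + 1" | (ia) "i \<ge> r" "a \<ge> 1" | (b) "b \<ge> r + 1"
    | (low) "a \<le> 1" "i + a \<le> r" "b \<le> r"
    by linarith
  thus ?case
  proof cases
    case a
    then obtain a' where a': "a = a' + 2" using le_Suc_ex by (metis add.commute)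
    show ?thesis
      by (rule step[of "i + 1" a' "b + 1" c]) (simp_all add: a' wt algebra_simps)
  next
    case i
    then obtain i' where i': "i = i' + (r + 1)" using le_Suc_ex by (metis add.commute)
    show ?thesis
      by (rule step[of i' a "b + r" c]) (simp_all add: i' wt algebra_simps)
  next
    case ia
    then obtain i' a' where ia': "i = i' + r" "a = a' + 1" using le_Suc_ex by (metis add.commute)
    show ?thesis
      by (rule step[of i' a' b "c + r"]) (simp_all add: ia' wt algebra_simps)
  next
    case b
    then obtain b' where b': "b = b' + (r + 1)" using le_Suc_ex by (metis add.commute)
    show ?thesis
      by (rule step[of i "a + 1" b' "c + r"]) (use r in \<open>simp_all add: b' wt algebra_simps\<close>)
  next
    case low
    define d D where "d = int (i + a + b + c)" and "D = int (emb_degree n)"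
    have D: "D = 2 * int r * int r + 2 * int r + 1"
      by (simp add: D_def emb_degree_def qq_eq r_def)
    \<comment> \<open>\<open>D\<close> is the weight of w. The factors x, y, z fall short of it by 2
      q0 + 1, q0 + 1 and 1, and the bounds of this case keep the total shortfall at most 2 q0^2 + 2
      q0 = \<open>D - 1\<close>.\<close>
    have "mon_wt n (int i) (int a) (int b) (int c)
            = d * D - (int i * (2 * int r + 1) + int a * (int r + 1) + int b)"
      by (simp add: wt D d_def algebra_simps)
    moreover have "int i * (2 * int r + 1) + int a * (int r + 1) + int b < D"
    proof -
      have "int i * (2 * int r + 1) + int a * (int r + 1) \<le> (int i + int a) * (2 * int r + 1)"
        by (simp add: algebra_simps)
      also have "\<dots> \<le> int r * (2 * int r + 1)"
        using low(2) by (intro mult_right_mono) auto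
      finally show ?thesis using low(3) by (simp add: D algebra_simps)
    qed
    ultimately have "d * D - D < int t * D"
      using less.prems by (simp add: D_def)
    hence "(d - 1) * D < int t * D" by (simp add: algebra_simps)
    hence "d - 1 < int t" by (rule mult_right_less_imp_less) (simp add: D_def)
    hence "i + a + b + c \<le> t" by (simp add: d_def)
    thus ?thesis by blast
  qed
qed

text \<open>Three divisions with remainder: the weight is the degree times \<open>D\<close> minus a
  shortfall \<open>e < D\<close>; \<open>e\<close> splits modulo 2 q0 + 1 into \<open>i\<close> and
  \<open>f\<close>, and \<open>f\<close> splits modulo q0 + 1 into \<open>a\<close> and
  \<open>b\<close>. The bound \<open>t \<le> q0 n\<close> keeps the remainders in range.\<close>

lemma mon_wt_inj_low_degree:
  assumes t: "t \<le> q0 n"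
    and eq: "mon_wt n (int i) (int a) (int b) (int c) = mon_wt n (int i') (int a') (int b') (int c')"
    and "a < 2" "i + a + b + c \<le> t" "a' < 2" "i' + a' + b' + c' \<le> t"
  shows "i = i' \<and> a = a' \<and> b = b' \<and> c = c'"
proof -
  define r where "r = int (q0 n)"
  have r: "r > 0" using q0_pos by (simp add: r_def)
  define D where "D = 2 * r * r + 2 * r + 1"
  have D: "D > 0" using r by (simp add: D_def add_pos_pos)
  define f where "f = (\<lambda>(a::nat) (b::nat). int a * (r + 1) + int b)"
  define e where "e = (\<lambda>(i::nat) (a::nat) (b::nat). int i * (2 * r + 1) + f a b)"
  define d where "d = int (i + a + b + c)"
  define d' where "d' = int (i' + a' + b' + c')"
  have wt: "mon_wt n (int i) (int a) (int b) (int c) = int (i + a + b + c) * D - e i a b" for i a b c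
    by (simp add: mon_wt_alt D_def e_def f_def algebra_simps flip: r_def)
  have f: "0 \<le> f a b \<and> f a b < 2 * r + 1 \<and> int b < r + 1" if "a < 2" "i + a + b + c \<le> t" for i a b c
  proof -
    have "a = 0 \<or> a = 1" using that by linarith
    thus ?thesis using that t r by (auto simp: f_def r_def)
  qed
  have e: "0 \<le> e i a b \<and> e i a b < D" if "a < 2" "i + a + b + c \<le> t" for i a b c
  proof -
    have "e i a b \<le> (int i + int a + int b) * (2 * r + 1)"
      using r by (simp add: e_def f_def algebra_simps)
    also have "\<dots> \<le> r * (2 * r + 1)"
      using that t r by (intro mult_right_mono) (auto simp: r_def)
    finally show ?thesis
      using f[OF that] r by (simp add: e_def D_def algebra_simps)
  qed
  have "d * D + e i' a' b' = d' * D + e i a b"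
    using eq unfolding wt d_def d'_def by linarith
  from mult_add_unique[OF this] have d: "d = d'" and ee: "e i' a' b' = e i a b"
    using e assms(3-6) by auto
  from mult_add_unique[OF ee[unfolded e_def]] have i: "int i' = int i" and ff: "f a' b' = f a b"
    using f assms(3-6) by auto
  from mult_add_unique[OF ff[unfolded f_def]] have "int a' = int a" "int b' = int b"
    using f assms(3-6) by auto
  thus ?thesis using i d by (simp add: d_def d'_def)
qed

section \<open>Counting monomials\<close>

lemma card_low_degree:
  assumes "t \<ge> 1"
  shows "card {(i, a, b, c). a < (2::nat) \<and> i + a + b + c \<le> t} = ((t + 3) choose 3) + ((t + 2) choose 3)"
proof -
  have card3: "card {(i, b, c). i + b + c \<le> m} = (m + 3) choose 3" for m :: nat
  proof -
    \<comment> \<open>The fourth entry is the slack that makes the sum exactly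
      \<open>m\<close>.\<close>
    have "bij_betw (\<lambda>(i, b, c). [i, b, c, m - i - b - c]) {(i, b, c). i + b + c \<le> m}
            {l. length l = 4 \<and> sum_list l = m}"
      by (rule bij_betwI[where g = "\<lambda>l. (l ! 0, l ! 1, l ! 2)"])
         (auto simp: numeral_eq_Suc length_Suc_conv)
    hence "card {(i, b, c). i + b + c \<le> m} = (m + 4 - 1) choose m"
      by (simp only: bij_betw_same_card card_length_sum_list)
    also have "m + 4 - 1 = m + 3" by simp
    finally have "card {(i, b, c). i + b + c \<le> m} = (m + 3) choose m" .
    thus ?thesis by (simp add: binomial_symmetric[of m])
  qed
  have fin: "finite {(i, b, c). i + b + c \<le> m}" for m :: nat
    by (rule finite_subset[of _ "{..m} \<times> {..m} \<times> {..m}"]) auto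
  define f where "f = (\<lambda>(a::nat) (i::nat, b::nat, c::nat). (i, a, b, c))"
  define A where "A = (\<lambda>m. {(i::nat, b::nat, c::nat). i + b + c \<le> m})"
  have inj: "card (f a ` A m) = card (A m)" for a m
    by (rule card_image) (auto simp: inj_on_def f_def)
  \<comment> \<open>For \<open>a = 1\<close> the other exponents have sum at most
    \<open>t - 1\<close>; the subtraction is exact since \<open>t \<ge> 1\<close>.\<close>
  have "{(i, a, b, c). a < (2::nat) \<and> i + a + b + c \<le> t} = f 0 ` A t \<union> f 1 ` A (t - 1)"
    using assms by (force simp: image_iff less_2_cases_iff f_def A_def)
  moreover have "card (f 0 ` A t \<union> f 1 ` A (t - 1)) = card (f 0 ` A t) + card (f 1 ` A (t - 1))"
    using fin by (intro card_Un_disjoint finite_imageI) (auto simp: f_def A_def)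
  ultimately show ?thesis
    unfolding inj using assms by (simp add: A_def card3)
qed

text \<open>Pascal's rule twice. The first two summands are the count of
  \<open>card_low_degree\<close>; the last is what they leave for \<open>kappa\<close>.\<close>

lemma choose_4_low_degree:
  "(t + 4) choose 4 = (((t + 3) choose 3) + ((t + 2) choose 3)) + ((t + 2) choose 4)"
  by (simp add: numeral_eq_Suc)

section \<open>The branch at infinity\<close>

text \<open>Signs are immaterial in characteristic two. Treating z and w as coordinates on a par
  with x and y exposes the symmetry of \<open>suzuki_relations_dual\<close>.\<close>

definition suzuki_relations :: "nat \<Rightarrow> 'b::comm_ring_1 \<Rightarrow> 'b \<Rightarrow> 'b \<Rightarrow> 'b \<Rightarrow> bool" where
  "suzuki_relations n x y z w \<longleftrightarrow>
     y ^ 2 = x * z + w \<and> z ^ q0 n = y + x ^ (q0 n + 1) \<and> w ^ q0 n = z + x ^ q0 n * y"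

lemma char2_add_self:
  "CHAR('b::comm_ring_1) = 2 \<Longrightarrow> x + x = (0 :: 'b)"
  by (metis mult_2 mult_zero_left of_nat_CHAR of_nat_numeral)

lemma char2_power_q0_add:
  fixes x y :: "'b::comm_ring_1"
  assumes "CHAR('b) = 2"
  shows "(x + y) ^ q0 n = x ^ q0 n + y ^ q0 n"
  by (rule freshmans_dream'[where n = n]) (simp_all add: assms q0_def)

lemma char2_power2_add:
  fixes x y :: "'b::comm_ring_1"
  assumes "CHAR('b) = 2"
  shows "(x + y) ^ 2 = x ^ 2 + y ^ 2"
  by (rule freshmans_dream) (simp_all add: assms)

text \<open>The automorphism of the curve that moves the point at infinity to the origin
  permutes the homogeneous coordinates as \<open>(1 : x : y : z : w) \<mapsto> (w : z : y : x : 1)\<close>.\<close>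

lemma suzuki_relations_dual:
  fixes x y z w :: "'b::field"
  assumes char: "CHAR('b) = 2" and rel: "suzuki_relations n x y z w" and w: "w \<noteq> 0"
  shows "suzuki_relations n (z / w) (y / w) (x / w) (1 / w)"
proof -
  let ?r = "q0 n"
  have 1: "y * y = x * z + w" and 2: "z ^ ?r = y + x * x ^ ?r" and 3: "w ^ ?r = z + x ^ ?r * y"
    using rel by (auto simp: suzuki_relations_def power2_eq_square)
  note two = char2_add_self[OF char]
  \<comment> \<open>Dividing this relation and the next one by w^(q0+1) gives the two Frobenius
    relations of the dual tuple.\<close>
  have "y * w ^ ?r + z * z ^ ?r = x ^ ?r * (y * y + x * z) + (y * z + y * z)"
    by (simp add: 2 3 algebra_simps)
  also have "\<dots> = x ^ ?r * w + (x ^ ?r * x * z + x ^ ?r * x * z)"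
    using two[of "y * z"] unfolding 1 by (simp add: algebra_simps)
  finally have 4: "y * w ^ ?r + z * z ^ ?r = x ^ ?r * w"
    by (simp add: two)
  have "x * w ^ ?r + y * z ^ ?r = y * y + x * z + (x * x ^ ?r * y + x * x ^ ?r * y)"
    by (simp add: 2 3 algebra_simps)
  also have "\<dots> = w + (x * z + x * z)"
    using two[of "x * x ^ ?r * y"] unfolding 1 by (simp add: algebra_simps)
  also have "\<dots> = w"
    unfolding two by simp
  finally have 5: "x * w ^ ?r + y * z ^ ?r = w" .
  have "x ^ ?r / w ^ ?r = (y * w ^ ?r + z * z ^ ?r) / (w * w ^ ?r)"
    using w by (simp add: 4)
  moreover have "1 / w ^ ?r = (x * w ^ ?r + y * z ^ ?r) / (w * w ^ ?r)"
    using w by (simp add: 5)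
  ultimately show ?thesis
    using w by (simp add: suzuki_relations_def 1 power_divide power2_eq_square add_divide_distrib mult.commute)
qed

text \<open>The series \<open>v\<close> is the compositional inverse of \<open>X - X\<^sup>q\<close>, composed with \<open>c\<close>.\<close>

lemma artin_schreier_fps_exists:
  fixes c :: "'b::field fps"
  assumes "fps_nth c 0 = 0" "q > 1"
  obtains v where "fps_nth v 0 = 0" "v - v ^ q = c"
proof -
  define G :: "'b fps" where "G = fps_X - fps_X ^ q"
  define v where "v = fps_inv G oo c"
  have G: "fps_nth G 0 = 0" "fps_nth G 1 \<noteq> 0"
    using assms(2) by (auto simp: G_def fps_X_power_nth)
  have I0: "fps_nth (fps_inv G) 0 = 0"
    by (simp add: fps_inv_def)
  have v0: "fps_nth v 0 = 0"
    by (simp add: v_def I0)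
  have "G oo v = (G oo fps_inv G) oo c"
    unfolding v_def by (rule fps_compose_assoc[OF assms(1) I0])
  also have "\<dots> = c"
    using assms(1) by (simp add: fps_inv_right[OF G])
  finally have "v - v ^ q = c"
    using v0 by (simp add: G_def fps_compose_sub_distrib flip: fps_compose_power)
  thus ?thesis using v0 that by blast
qed

text \<open>At the origin x is a local parameter, so it may be taken as \<open>fls_X\<close>, and y
  solves an Artin-Schreier equation over power series.\<close>

lemma suzuki_branch_at_origin:
  assumes char: "CHAR('a::field) = 2" and n: "n \<ge> 1"
  obtains y z w :: "'a::field fls" where "suzuki_relations n fls_X y z w" "y \<noteq> 0" "z \<noteq> 0" "w \<noteq> 0"
    "fls_subdegree y = int (q0 n) + 1" "fls_subdegree z = 2 * int (q0 n) + 1"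
    "fls_subdegree w = int (qq n) + 2 * int (q0 n) + 1"
proof -
  define r q where "r = q0 n" and "q = qq n"
  have r: "r \<ge> 2" using n self_le_power[of 2 n] power_increasing[of 1 n "2::nat"] by (simp add: r_def q0_def)
  have q: "q = 2 * r * r" by (simp add: q_def r_def qq_def power2_eq_square)
  have "1 * r < 2 * r * r" using r by (intro mult_strict_right_mono) auto
  hence "q > r" by (simp add: q)
  hence qr: "q > r" "q > 1" using r by linarith+
  have char': "CHAR('a fls) = 2" by (simp add: char)
  note two = char2_add_self[OF char']
  note frob = char2_power_q0_add[OF char', of _ _ n, folded r_def]
  let ?s = "fls_X :: 'a fls"
  \<comment> \<open>In characteristic two this is the curve equation.\<close>
  obtain v :: "'a fps" where v: "fps_nth v 0 = 0" "v - v ^ q = fps_X ^ (r + 1) + fps_X ^ (r + q)"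
    by (rule artin_schreier_fps_exists[of "fps_X ^ (r + 1) + fps_X ^ (r + q)" q])
       (use qr in \<open>auto simp: fps_X_power_nth\<close>)
  define y where "y = fps_to_fls v"
  define z where "z = ?s ^ (2 * r + 1) + y ^ (2 * r)"
  define w where "w = y ^ 2 + ?s * z"
  have y1: "y - y ^ q = ?s ^ (r + 1) + ?s ^ (r + q)"
    unfolding y_def using arg_cong[OF v(2), of fps_to_fls]
    by (simp add: fps_to_fls_power del: power_Suc)
  have sum_eq: "fls_subdegree (?s ^ (r + 1) + ?s ^ (r + q)) = int (r + 1)"
    using qr by (subst fls_subdegree_add_eq1) (auto simp del: of_nat_add power_add power_Suc)
  have "fls_subdegree y > 0" if "y \<noteq> 0"
    using that v(1) unfolding y_def fls_subdegree_fls_to_fps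
    by (simp add: subdegree_pos_iff)
  moreover have "y \<noteq> 0"
  proof
    assume "y = 0"
    hence "?s ^ (r + 1) + ?s ^ (r + q) = 0" using y1 qr by (simp add: power_0_left)
    thus False using sum_eq by simp
  qed
  ultimately have y: "y \<noteq> 0" "fls_subdegree y > 0" by auto
  have "fls_subdegree (y - y ^ q) = fls_subdegree y"
    using y qr by (intro fls_subdegree_diff_eq1) (auto simp: fls_subdegree_pow)
  hence sy: "fls_subdegree y = int r + 1"
    unfolding y1 sum_eq by simp
  have "int 1 < int (r * (r * 2))"
    using qr(2) by (subst of_nat_less_iff) (simp add: q mult_ac)
  hence r2: "1 < int r * (int r * 2)"
    by (simp only: of_nat_mult of_nat_1 of_nat_numeral)
  have sz: "fls_subdegree z = 2 * int r + 1"
    unfolding z_def using r y(1) r2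
    by (subst fls_subdegree_add_eq1)
       (auto simp: fls_subdegree_pow sy algebra_simps simp del: power_add power_Suc)
  hence z: "z \<noteq> 0" using r by auto
  have minus: "a - b = a + b" for a b :: "'a fls"
    using two[of b] by (simp add: algebra_simps flip: add_eq_0_iff)
  have R1: "z ^ r = y + ?s ^ (r + 1)"
  proof -
    have "z ^ r = ?s ^ (r + q) + y ^ q"
      unfolding z_def frob by (simp add: q algebra_simps flip: power_mult power_add)
    also have "y ^ q = y - (?s ^ (r + 1) + ?s ^ (r + q))"
      unfolding y1[symmetric] by simp
    also have "?s ^ (r + q) + (y - (?s ^ (r + 1) + ?s ^ (r + q))) = y - ?s ^ (r + 1)"
      by (simp del: power_add power_Suc)
    finally show ?thesis unfolding minus .
  qed
  have R2: "y ^ 2 = ?s * z + w"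
    unfolding w_def using two[of "?s * z"] by (simp add: algebra_simps)
  have R3: "w ^ r = z + ?s ^ r * y"
  proof -
    have "w ^ r = y ^ (2 * r) + ?s ^ r * (y + ?s ^ (r + 1))"
      unfolding w_def frob power_mult_distrib R1 by (simp flip: power_mult)
    also have "\<dots> = z + ?s ^ r * y"
    proof -
      have "?s ^ (2 * r + 1) = ?s ^ r * ?s ^ (r + 1)"
        unfolding power_add[symmetric] by (simp add: mult_2)
      thus ?thesis by (simp only: z_def distrib_left add_ac)
    qed
    finally show ?thesis .
  qed
  \<comment> \<open>In y^2 + x z both terms have order 2 q0 + 2 and their leading parts cancel,
    which hides the order of \<open>w\<close>. In this form the first term alone has lowest
    order.\<close>
  have w_alt: "w = ?s * y ^ (2 * r) + z ^ (2 * r)"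
  proof -
    have "z ^ (2 * r) = (y + ?s ^ (r + 1)) ^ 2"
      unfolding R1[symmetric] by (simp add: mult.commute flip: power_mult)
    also have "\<dots> = y ^ 2 + ?s * ?s ^ (2 * r + 1)"
      unfolding char2_power2_add[OF char']
      by (simp add: algebra_simps flip: power_mult power_Suc)
    finally show ?thesis
      by (simp add: w_def z_def algebra_simps)
  qed
  have sw: "fls_subdegree w = int q + 2 * int r + 1"
  proof -
    have "fls_subdegree (?s * y ^ (2 * r)) < fls_subdegree (z ^ (2 * r))"
      using y(1) z r r2 by (simp add: fls_subdegree_pow sy sz algebra_simps)
    hence "fls_subdegree w = fls_subdegree (?s * y ^ (2 * r))"
      unfolding w_alt using y(1) by (intro fls_subdegree_add_eq1) auto
    also have "\<dots> = int q + 2 * int r + 1"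
      using y(1) by (simp add: fls_subdegree_pow sy q algebra_simps)
    finally show ?thesis .
  qed
  hence w: "w \<noteq> 0" by auto
  have "suzuki_relations n ?s y z w"
    using R1 R2 R3 by (simp add: suzuki_relations_def r_def)
  thus ?thesis
    using that y(1) z w sy sz sw by (simp add: r_def q_def)
qed

text \<open>The plane model has a cusp at infinity, so the branch is carried over from the origin by
  the duality; the subdegrees become differences with that of w.\<close>

lemma suzuki_branch_at_infinity:
  assumes char: "CHAR('a::field) = 2" and n: "n \<ge> 1"
  obtains x y z w :: "'a::field fls" where "suzuki_relations n x y z w"
    "x \<noteq> 0" "y \<noteq> 0" "z \<noteq> 0" "w \<noteq> 0"
    "fls_subdegree x = - int (qq n)" "fls_subdegree y = - int (qq n + q0 n)"
    "fls_subdegree z = - int (qq n + 2 * q0 n)" "fls_subdegree w = - int (qq n + 2 * q0 n + 1)"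
proof -
  obtain y z w :: "'a fls" where yzw: "suzuki_relations n fls_X y z w" "y \<noteq> 0" "z \<noteq> 0" "w \<noteq> 0"
    "fls_subdegree y = int (q0 n) + 1" "fls_subdegree z = 2 * int (q0 n) + 1"
    "fls_subdegree w = int (qq n) + 2 * int (q0 n) + 1"
    by (rule suzuki_branch_at_origin[OF char n])
  show ?thesis
  proof (rule that)
    show "suzuki_relations n (z / w) (y / w) (fls_X / w) (1 / w)"
      using yzw char by (intro suzuki_relations_dual) auto
  qed (use yzw in \<open>auto simp: fls_divide_subdegree\<close>)
qed

section \<open>Reduction modulo the Suzuki polynomial\<close>

text \<open>This lemma and the next are applied to two nested coefficient maps:
  \<open>fls_const\<close>, and then evaluation of the inner variable.\<close>

lemma poly_map_poly_add:
  assumes "h 0 = 0" "\<And>a b. h (a + b) = h a + h b"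
  shows "poly (map_poly h (p + q)) y = poly (map_poly h p) y + poly (map_poly h q) (y::'b::comm_ring_1)"
proof -
  have "map_poly h (p + q) = map_poly h p + map_poly h q"
    using assms by (intro poly_eqI) (simp add: coeff_map_poly)
  thus ?thesis by simp
qed

lemma poly_map_poly_mult:
  assumes h: "h 0 = 0" "\<And>a b. h (a + b) = h a + h b" "\<And>a b. h (a * b) = h a * h b"
  shows "poly (map_poly h (p * q)) y = poly (map_poly h p) y * poly (map_poly h q) (y::'b::comm_ring_1)"
proof (induction p)
  case (pCons a p)
  have "poly (map_poly h (pCons a p * q)) y
          = poly (map_poly h (smult a q)) y + poly (map_poly h (pCons 0 (p * q))) y"
    by (simp add: poly_map_poly_add h)
  also have "\<dots> = h a * poly (map_poly h q) y + y * (poly (map_poly h p) y * poly (map_poly h q) y)"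
    by (simp add: map_poly_smult map_poly_pCons h pCons.IH)
  finally show ?case
    by (simp add: map_poly_pCons h algebra_simps)
qed simp

section \<open>Evaluation of bivariate polynomials at Laurent series\<close>

definition eval_fls :: "'a::field fls \<Rightarrow> 'a fls \<Rightarrow> 'a poly poly \<Rightarrow> 'a fls" where
  "eval_fls x y p = poly (map_poly (\<lambda>q. poly (map_poly fls_const q) x) p) y"

lemma eval_fls_add: "eval_fls x y (p + q) = eval_fls x y p + eval_fls x y q"
  unfolding eval_fls_def
  by (intro poly_map_poly_add) (simp_all add: poly_map_poly_add fls_plus_const)

lemma eval_fls_mult: "eval_fls x y (p * q) = eval_fls x y p * eval_fls x y q"
  unfolding eval_fls_def
  by (intro poly_map_poly_mult) (simp_all add: poly_map_poly_add poly_map_poly_mult fls_plus_const)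

lemma eval_fls_const: "eval_fls x y [:[:c:]:] = fls_const c"
  by (simp add: eval_fls_def map_poly_pCons)

lemma eval_fls_0: "eval_fls x y 0 = 0"
  by (simp add: eval_fls_def)

lemma eval_fls_1: "eval_fls x y 1 = 1"
  by (simp add: eval_fls_def)

lemma eval_fls_diff: "eval_fls x y (p - q) = eval_fls x y p - eval_fls x y q"
  using eval_fls_add[of x y "p - q" q] by simp

lemma eval_fls_power: "eval_fls x y (p ^ k) = eval_fls x y p ^ k"
  by (induction k) (simp_all add: eval_fls_1 eval_fls_mult)

lemma eval_fls_sum: "eval_fls x y (sum g A) = (\<Sum>i\<in>A. eval_fls x y (g i))"
  by (induction A rule: infinite_finite_induct) (simp_all add: eval_fls_0 eval_fls_add)

lemma eval_fls_prod: "eval_fls x y (prod g A) = (\<Prod>i\<in>A. eval_fls x y (g i))"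
  by (induction A rule: infinite_finite_induct) (simp_all add: eval_fls_1 eval_fls_mult)

definition Y_fn :: "'a::field poly poly" where "Y_fn = [:0, 1:]"

text \<open>The classical function z of the Suzuki curve, of pole order q + 2 q0 at
  infinity.\<close>

definition Z_fn :: "nat \<Rightarrow> 'a::field poly poly" where
  "Z_fn n = X_fn ^ (2 * q0 n + 1) + Y_fn ^ (2 * q0 n)"

text \<open>Classically w is x y^(2 q0) + z^(2 q0), which agrees with this modulo f. In the present
  form y^2 = x z + w is an identity of polynomials in characteristic two.\<close>

definition W_fn :: "nat \<Rightarrow> 'a::field poly poly" where
  "W_fn n = Y_fn ^ 2 + X_fn * Z_fn n"

definition mon_fn :: "nat \<Rightarrow> nat \<Rightarrow> nat \<Rightarrow> nat \<Rightarrow> nat \<Rightarrow> 'a::field poly poly" where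
  "mon_fn n i a b c = X_fn ^ i * Y_fn ^ a * Z_fn n ^ b * W_fn n ^ c"

lemma eval_fls_X: "eval_fls x y X_fn = x"
  by (simp add: eval_fls_def X_fn_def map_poly_pCons)

lemma eval_fls_Y: "eval_fls x y Y_fn = y"
  by (simp add: eval_fls_def Y_fn_def map_poly_pCons)

lemma monom_bivariate: "monom (monom a i) j = [:[:a:]:] * X_fn ^ i * Y_fn ^ j"
proof -
  have "[:[:a:]:] * X_fn ^ i = [:monom a i:]"
    by (induction i) (simp_all add: X_fn_def monom_0 monom_Suc algebra_simps)
  moreover have "Y_fn ^ j = monom (1 :: 'a poly) j"
    by (induction j) (simp_all add: Y_fn_def monom_0 monom_Suc flip: one_pCons)
  ultimately show ?thesis by (simp add: smult_monom)
qed

lemma monom_sum: "monom (sum f A) j = (\<Sum>i\<in>A. monom (f i) j)"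
  by (induction A rule: infinite_finite_induct) (simp_all flip: add_monom)

lemma poly_poly_sum_monomials:
  "p = (\<Sum>j\<le>degree p. \<Sum>i\<le>degree (coeff p j). [:[:coeff (coeff p j) i:]:] * (X_fn ^ i * Y_fn ^ j))"
proof -
  have "p = (\<Sum>j\<le>degree p. monom (coeff p j) j)"
    by (rule poly_as_sum_of_monoms[symmetric])
  also have "\<dots> = (\<Sum>j\<le>degree p. monom (\<Sum>i\<le>degree (coeff p j). monom (coeff (coeff p j) i) i) j)"
    by (simp only: poly_as_sum_of_monoms)
  also have "\<dots> = (\<Sum>j\<le>degree p. \<Sum>i\<le>degree (coeff p j). monom (monom (coeff (coeff p j) i) i) j)"
    by (simp only: monom_sum)
  finally show ?thesis
    by (simp only: monom_bivariate mult.assoc)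
qed

lemma suzuki_poly_alt:
  "suzuki_poly n = Y_fn ^ qq n - Y_fn - (X_fn ^ (q0 n + qq n) - X_fn ^ (q0 n + 1))"
proof -
  have "monom 1 k = (Y_fn ^ k :: 'a poly poly)" "[:monom 1 k:] = (X_fn ^ k :: 'a poly poly)" for k
    using monom_bivariate[of "1::'a" 0 k] monom_bivariate[of "1::'a" k 0]
    by (simp_all add: monom_0 flip: one_pCons)
  moreover have "[:u - v:] = [:u:] - [:v :: 'a poly:]" for u v
    by simp
  ultimately show ?thesis
    unfolding suzuki_poly_def by (simp only: power_one_right)
qed

section \<open>Normal forms modulo the Suzuki polynomial\<close>

global_interpretation pp: vector_space "\<lambda>(c::'a::field) (p :: 'a poly poly). smult [:c:] p"
  by unfold_locales (simp_all add: smult_add_right mult.commute flip: smult_add_left one_pCons)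

definition reduced_monomials :: "nat \<Rightarrow> 'a::field poly poly set" where
  "reduced_monomials n = {mon_fn n i a b c | i a b c. a < 2 \<and> b < q0 n \<and> c < q0 n}"

context
  fixes n :: nat
  assumes char: "CHAR('a::field) = 2"
begin

lemma char_pp: "CHAR('a poly poly) = 2"
  by (simp add: char)

lemma pp_minus: "a - b = a + (b :: 'a poly poly)"
  using char2_add_self[OF char_pp, of b] by (simp add: algebra_simps flip: add_eq_0_iff)

lemma Y_fn_square: "Y_fn ^ 2 = X_fn * Z_fn n + (W_fn n :: 'a poly poly)"
  using char2_add_self[OF char_pp, of "X_fn * Z_fn n"] by (simp add: W_fn_def algebra_simps)

text \<open>Frobenius gives z^q0 = x^(q0+q) + y^q, and f exchanges this for lower terms. The
  multiple of f is kept, so that the congruence is an identity of polynomials.\<close>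

lemma Z_fn_power: "Z_fn n ^ q0 n = Y_fn + X_fn ^ (q0 n + 1) + (suzuki_poly n :: 'a poly poly)"
proof -
  have "Z_fn n ^ q0 n = X_fn ^ ((2 * q0 n + 1) * q0 n) + (Y_fn ^ (2 * q0 n * q0 n) :: 'a poly poly)"
    by (simp only: Z_fn_def char2_power_q0_add[OF char_pp] power_mult[symmetric])
  also have "\<dots> = X_fn ^ (q0 n + qq n) + (Y_fn ^ qq n :: 'a poly poly)"
    by (simp add: qq_def power2_eq_square algebra_simps)
  also have "\<dots> = Y_fn + X_fn ^ (q0 n + 1) + (suzuki_poly n :: 'a poly poly)"
  proof -
    have "u + v = s + t + (v + s + (u + t))" for s t u v :: "'a poly poly"
    proof -
      have "s + t + (v + s + (u + t)) = u + v + (s + s) + (t + t)" by (simp only: add_ac)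
      thus ?thesis by (simp only: char2_add_self[OF char_pp] add_0_right)
    qed
    thus ?thesis unfolding suzuki_poly_alt pp_minus by blast
  qed
  finally show ?thesis .
qed

lemma W_fn_power:
  "W_fn n ^ q0 n = Z_fn n + X_fn ^ q0 n * Y_fn + X_fn ^ q0 n * (suzuki_poly n :: 'a poly poly)"
proof -
  have "W_fn n ^ q0 n = Y_fn ^ (2 * q0 n) + X_fn ^ q0 n * (Z_fn n ^ q0 n :: 'a poly poly)"
    by (simp only: W_fn_def char2_power_q0_add[OF char_pp] power_mult[symmetric] power_mult_distrib)
  also have "X_fn ^ (2 * q0 n + 1) = X_fn ^ q0 n * (X_fn ^ (q0 n + 1) :: 'a poly poly)"
    unfolding power_add[symmetric] by (simp add: mult_2)
  hence "Y_fn ^ (2 * q0 n) + X_fn ^ q0 n * (Z_fn n ^ q0 n :: 'a poly poly)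
     = Z_fn n + X_fn ^ q0 n * Y_fn + X_fn ^ q0 n * (suzuki_poly n :: 'a poly poly)"
    unfolding Z_fn_power by (simp only: Z_fn_def distrib_left add_ac)
  finally show ?thesis .
qed

text \<open>The three relations act as rewrite rules, and the multiples of f are collected in the
  second set of generators.\<close>

lemma mon_fn_in_span:
  assumes "n \<ge> 1"
  shows "(mon_fn n i a b c :: 'a poly poly) \<in> pp.span (reduced_monomials n \<union> range ((*) (suzuki_poly n)))"
    (is "_ \<in> ?N")
\<comment> \<open>The weights 2, 3, 3, with x free, decrease in every rewriting: y^2 costs 4 against
  3 for z or w, and w^q0 costs 3 q0 against 3 for z, which is less because q0 is at least 2.\<close>
proof (induction "2 * a + 3 * b + 3 * c" arbitrary: i a b c rule: less_induct)
  case less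
  note IH = less.hyps
  have r: "q0 n \<ge> 2" using assms power_increasing[of 1 n "2::nat"] by (simp add: q0_def)
  have f: "suzuki_poly n * u \<in> ?N" for u :: "'a poly poly"
    by (rule pp.span_base) auto
  consider "a \<ge> 2" | "b \<ge> q0 n" | "c \<ge> q0 n" | "a < 2" "b < q0 n" "c < q0 n"
    by linarith
  thus ?case
  proof cases
    case 1
    then obtain a' where a: "a = a' + 2" using le_Suc_ex by (metis add.commute)
    have "mon_fn n i a b c = mon_fn n (i + 1) a' (b + 1) c + (mon_fn n i a' b (c + 1) :: 'a poly poly)"
      by (simp only: mon_fn_def a power_add Y_fn_square) (simp add: algebra_simps)
    thus ?thesis
      using IH[of a' "b + 1" c "i + 1"] IH[of a' b "c + 1" i] a by (auto intro: pp.span_add)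
  next
    case 2
    then obtain b' where b: "b = b' + q0 n" using le_Suc_ex by (metis add.commute)
    have "mon_fn n i a b c = mon_fn n i (a + 1) b' c + mon_fn n (i + (q0 n + 1)) a b' c
            + suzuki_poly n * (mon_fn n i a b' c :: 'a poly poly)"
      by (simp only: mon_fn_def b power_add Z_fn_power) (simp add: algebra_simps)
    thus ?thesis
      using IH[of "a + 1" b' c i] IH[of a b' c "i + (q0 n + 1)"] f b r by (auto intro!: pp.span_add)
  next
    case 3
    then obtain c' where c: "c = c' + q0 n" using le_Suc_ex by (metis add.commute)
    have "mon_fn n i a b c = mon_fn n i a (b + 1) c' + mon_fn n (i + q0 n) (a + 1) b c'
            + suzuki_poly n * (mon_fn n (i + q0 n) a b c' :: 'a poly poly)"
      by (simp only: mon_fn_def c power_add W_fn_power) (simp add: algebra_simps)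
    thus ?thesis
      using IH[of a "b + 1" c' i] IH[of "a + 1" b c' "i + q0 n"] f c r by (auto intro!: pp.span_add)
  next
    case 4
    thus ?thesis by (intro pp.span_base) (auto simp: reduced_monomials_def)
  qed
qed

text \<open>The multiples of f form a subspace, so the span of the union splits into a normal form
  plus a multiple of f.\<close>

lemma reduced_monomials_span:
  fixes p :: "'a poly poly"
  assumes "n \<ge> 1"
  obtains h u where "h \<in> pp.span (reduced_monomials n)" "p = h + suzuki_poly n * u"
proof -
  let ?N = "pp.span (reduced_monomials n \<union> range ((*) (suzuki_poly n)))"
  have "[:[:c:]:] * (X_fn ^ i * Y_fn ^ j) \<in> ?N" for c :: 'a and i j
    using pp.span_scale[OF mon_fn_in_span[OF assms, of i j 0 0]] by (simp add: mon_fn_def)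
  hence "p \<in> ?N"
    by (subst poly_poly_sum_monomials) (intro pp.span_sum)
  moreover have "pp.subspace (range ((*) (suzuki_poly n :: 'a poly poly)))"
  proof (rule pp.subspaceI)
    show "0 \<in> range ((*) (suzuki_poly n :: 'a poly poly))"
      by (rule range_eqI[of _ _ 0]) simp
  next
    fix a b :: "'a poly poly"
    assume "a \<in> range ((*) (suzuki_poly n))" "b \<in> range ((*) (suzuki_poly n))"
    then obtain u v where "a = suzuki_poly n * u" "b = suzuki_poly n * v" by blast
    thus "a + b \<in> range ((*) (suzuki_poly n))"
      by (intro range_eqI[of _ _ "u + v"]) (simp only: distrib_left)
  next
    fix a :: "'a poly poly" and c
    assume "a \<in> range ((*) (suzuki_poly n))"
    then obtain u where "a = suzuki_poly n * u" by blast
    thus "smult [:c:] a \<in> range ((*) (suzuki_poly n))"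
      by (intro range_eqI[of _ _ "smult [:c:] u"]) simp
  qed
  hence "pp.span (range ((*) (suzuki_poly n :: 'a poly poly))) = range ((*) (suzuki_poly n))"
    by (rule pp.span_eq_iff[THEN iffD2])
  ultimately obtain h g where "h \<in> pp.span (reduced_monomials n)"
      "g \<in> range ((*) (suzuki_poly n :: 'a poly poly))" "p = h + g"
    unfolding pp.span_Un by blast
  thus ?thesis using that by blast
qed

end

section \<open>Evaluation at the branch and places\<close>

text \<open>The construction of the series stays hidden: from here on only their relations,
  nonvanishing and orders enter.\<close>

locale suzuki_branch =
  fixes n :: nat and x y z w :: "'a::field fls"
  assumes char: "CHAR('a) = 2" and n: "n \<ge> 1"
    and rel: "suzuki_relations n x y z w"
    and nonzero: "x \<noteq> 0" "y \<noteq> 0" "z \<noteq> 0" "w \<noteq> 0"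
    and subdegree_coords: "fls_subdegree x = - int (qq n)" "fls_subdegree y = - int (qq n + q0 n)"
      "fls_subdegree z = - int (qq n + 2 * q0 n)" "fls_subdegree w = - int (qq n + 2 * q0 n + 1)"
begin

abbreviation ev :: "'a poly poly \<Rightarrow> 'a fls" where "ev \<equiv> eval_fls x y"

lemmas ev_simps = eval_fls_add eval_fls_mult eval_fls_diff eval_fls_power eval_fls_0 eval_fls_1
  eval_fls_const eval_fls_X eval_fls_Y

lemma char_fls: "CHAR('a fls) = 2"
  by (simp add: char)

lemma fls_add_self: "u + u = (0 :: 'a fls)"
  by (rule char2_add_self[OF char_fls])

lemma relations:
  "y ^ 2 = x * z + w" "z ^ q0 n = y + x ^ (q0 n + 1)" "w ^ q0 n = z + x ^ q0 n * y"
  using rel by (simp_all only: suzuki_relations_def)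

text \<open>The q0-th power of y^2 = x z + w expresses y^(2 q0) through the other two relations;
  every term except z then occurs twice.\<close>

lemma ev_Z: "ev (Z_fn n) = z"
proof -
  have 1: "y ^ (2 * q0 n) = x ^ q0 n * (y + x ^ (q0 n + 1)) + (z + x ^ q0 n * y)"
    by (simp only: power_mult relations(1) char2_power_q0_add[OF char_fls] power_mult_distrib relations(2,3))
  have 2: "x ^ (2 * q0 n + 1) = x ^ q0 n * x ^ (q0 n + 1)"
    unfolding power_add[symmetric] by (simp add: mult_2)
  have "x ^ (2 * q0 n + 1) + y ^ (2 * q0 n)
      = x ^ q0 n * x ^ (q0 n + 1) + (x ^ q0 n * (y + x ^ (q0 n + 1)) + (z + x ^ q0 n * y))"
    by (simp only: 1 2)
  also have "\<dots> = z + (x ^ q0 n * x ^ (q0 n + 1) + x ^ q0 n * x ^ (q0 n + 1)) + (x ^ q0 n * y + x ^ q0 n * y)"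
    by (simp only: distrib_left add_ac)
  also have "\<dots> = z" by (simp only: fls_add_self add_0_right)
  finally show ?thesis by (simp only: Z_fn_def ev_simps)
qed

lemma ev_W: "ev (W_fn n) = w"
proof -
  have "y ^ 2 + x * z = w + (x * z + x * z)" by (simp only: relations(1) add_ac)
  thus ?thesis by (simp only: W_fn_def ev_simps ev_Z fls_add_self add_0_right)
qed

text \<open>Comparing \<open>Z_fn_power\<close> with the relation for z^q0 leaves the value of f as
  the difference.\<close>

lemma ev_suzuki_poly: "ev (suzuki_poly n) = 0"
  using arg_cong[OF Z_fn_power[OF char, of n], of ev] relations(2)
  by (simp only: ev_simps ev_Z) (simp del: power_Suc)

lemma ev_mon: "ev (mon_fn n i a b c) = x ^ i * y ^ a * z ^ b * w ^ c"
  by (simp only: mon_fn_def ev_simps ev_Z ev_W)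

lemma ev_mon_nonzero: "ev (mon_fn n i a b c) \<noteq> 0"
  using nonzero by (simp add: ev_mon)

lemma subdegree_mon:
  "fls_subdegree (x ^ i * y ^ a * z ^ b * w ^ c) = - mon_wt n (int i) (int a) (int b) (int c)"
  using nonzero by (simp add: fls_subdegree_pow subdegree_coords mon_wt_def algebra_simps)

text \<open>Reduced monomials have pairwise distinct pole orders by
  \<open>mon_wt_reduced_unique\<close>, so the leading term of a combination survives.\<close>

lemma ev_span_reduced_monomials:
  assumes "h \<in> pp.span (reduced_monomials n)" "h \<noteq> 0"
  shows "ev h \<noteq> 0" "- fls_subdegree (ev h) \<in> pole_semigroup n"
proof -
  from assms(1) obtain T c where T: "finite T" "T \<subseteq> reduced_monomials n"
      "h = (\<Sum>p\<in>T. smult [:c p:] p)"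
    unfolding pp.span_explicit by blast
  define T' where "T' = {p \<in> T. c p \<noteq> 0}"
  have h: "h = (\<Sum>p\<in>T'. smult [:c p:] p)"
    unfolding T(3) using T(1) by (intro sum.mono_neutral_right) (auto simp: T'_def)
  have T': "finite T'" "T' \<noteq> {}"
  proof -
    show "finite T'" using T(1) by (simp add: T'_def)
    show "T' \<noteq> {}"
    proof
      assume "T' = {}"
      hence "h = 0" by (subst h) (simp only: sum.empty)
      with assms(2) show False by contradiction
    qed
  qed
  have ev_term: "ev (smult [:c p:] p) = fls_const (c p) * ev p" for p
    using eval_fls_mult[of x y "[:[:c p:]:]" p] by (simp add: ev_simps)
  have mon: "\<exists>i a b c. p = mon_fn n i a b c \<and> a < 2 \<and> b < q0 n \<and> c < q0 n" if "p \<in> T'" for p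
    using that T(2) by (auto simp: T'_def reduced_monomials_def)
  have nz: "ev (smult [:c p:] p) \<noteq> 0" if "p \<in> T'" for p
    using mon[OF that] that ev_mon_nonzero by (auto simp: ev_term T'_def)
  have sub: "fls_subdegree (ev (smult [:c p:] p)) = fls_subdegree (ev p)" if "p \<in> T'" for p
    using that by (simp only: ev_term) (simp add: T'_def fls_subdegree_scale)
  have "inj_on (\<lambda>p. fls_subdegree (ev (smult [:c p:] p))) T'"
  proof (rule inj_onI)
    fix p p' assume *: "p \<in> T'" "p' \<in> T'"
      "fls_subdegree (ev (smult [:c p:] p)) = fls_subdegree (ev (smult [:c p':] p'))"
    obtain i a b d where p: "p = mon_fn n i a b d" "a < 2" "b < q0 n" "d < q0 n"
      using mon[OF *(1)] by blast
    obtain i' a' b' d' where p': "p' = mon_fn n i' a' b' d'" "a' < 2" "b' < q0 n" "d' < q0 n"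
      using mon[OF *(2)] by blast
    have "mon_wt n (int i) (int a) (int b) (int d) = mon_wt n (int i') (int a') (int b') (int d')"
      using *(3) unfolding sub[OF *(1)] sub[OF *(2)] by (simp add: p p' ev_mon subdegree_mon)
    from mon_wt_reduced_unique[OF this] p p' show "p = p'" by simp
  qed
  from fls_sum_distinct_subdegree[OF T' nz this]
  have "ev h \<noteq> 0" and "fls_subdegree (ev h) \<in> (\<lambda>p. fls_subdegree (ev (smult [:c p:] p))) ` T'"
    by (simp_all add: h eval_fls_sum)
  then obtain p where p: "p \<in> T'" "fls_subdegree (ev h) = fls_subdegree (ev p)"
    using sub by auto
  show "ev h \<noteq> 0" by fact
  show "- fls_subdegree (ev h) \<in> pole_semigroup n"
  proof -
    obtain i a b d where "p = mon_fn n i a b d" and abd: "a < 2" "b < q0 n" "d < q0 n"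
      using mon[OF p(1)] by blast
    hence "- fls_subdegree (ev h) = mon_wt n (int i) (int a) (int b) (int d)"
      using p(2) by (simp add: ev_mon subdegree_mon)
    thus ?thesis
      unfolding pole_semigroup_def using abd by blast
  qed
qed

text \<open>A polynomial and its normal form have the same value, and only the zero normal form has
  value zero. This turns the definitions phrased by divisibility into statements about series, where
  quotients are available.\<close>

lemma dvd_iff_ev: "suzuki_poly n dvd p \<longleftrightarrow> ev p = 0"
proof
  assume "suzuki_poly n dvd p"
  thus "ev p = 0" by (auto simp: ev_simps ev_suzuki_poly elim!: dvdE)
next
  assume p: "ev p = 0"
  obtain h u where hu: "h \<in> pp.span (reduced_monomials n)" "p = h + suzuki_poly n * u"
    by (rule reduced_monomials_span[OF char n])
  have "ev h = 0" using p by (simp add: hu ev_simps ev_suzuki_poly)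
  hence "h = 0" using ev_span_reduced_monomials(1)[OF hu(1)] by blast
  thus "suzuki_poly n dvd p" by (simp add: hu)
qed

lemma ev_pole:
  assumes "ev p \<noteq> 0"
  shows "- fls_subdegree (ev p) \<in> pole_semigroup n"
proof -
  obtain h u where hu: "h \<in> pp.span (reduced_monomials n)" "p = h + suzuki_poly n * u"
    by (rule reduced_monomials_span[OF char n])
  have "ev h = ev p" by (simp add: hu ev_simps ev_suzuki_poly)
  thus ?thesis
    using ev_span_reduced_monomials(2)[OF hu(1)] assms by (cases "h = 0") (auto simp: ev_simps)
qed

end

section \<open>Places of the function field in terms of the branch\<close>

locale suzuki_place = suzuki_branch +
  fixes v :: "'a poly poly \<Rightarrow> int"
  assumes place: "is_place n v"
begin

lemma v_mult: "ev g \<noteq> 0 \<Longrightarrow> ev h \<noteq> 0 \<Longrightarrow> v (g * h) = v g + v h"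
  using place unfolding is_place_def Let_def dvd_iff_ev by blast

lemma v_cong:
  assumes "ev g \<noteq> 0" "ev g = ev g'"
  shows "v g' = v g"
proof -
  have "\<forall>g g'. ev g \<noteq> 0 \<longrightarrow> ev (g - g') = 0 \<longrightarrow> v g' = v g"
    using place unfolding is_place_def Let_def dvd_iff_ev by blast
  moreover have "ev (g - g') = 0" using assms(2) by (simp add: ev_simps)
  ultimately show ?thesis using assms(1) by blast
qed

lemma v_add: "ev g \<noteq> 0 \<Longrightarrow> ev h \<noteq> 0 \<Longrightarrow> ev (g + h) \<noteq> 0 \<Longrightarrow> min (v g) (v h) \<le> v (g + h)"
  using place unfolding is_place_def Let_def dvd_iff_ev by blast

lemma v_const: "c \<noteq> 0 \<Longrightarrow> v [:[:c:]:] = 0"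
  using place unfolding is_place_def Let_def by blast

lemma v_normalized: "\<exists>g h. ev g \<noteq> 0 \<and> ev h \<noteq> 0 \<and> v g - v h = 1"
  using place unfolding is_place_def Let_def dvd_iff_ev by blast

lemma v_1: "v 1 = 0"
  using v_const[of 1] by (simp flip: one_pCons)

lemma v_power: "ev g \<noteq> 0 \<Longrightarrow> v (g ^ k) = int k * v g"
  by (induction k) (simp_all add: v_1 v_mult ev_simps algebra_simps)

text \<open>In characteristic two g = g + h + h, so a value of g + h above that of g would force a
  larger value of g as well.\<close>

lemma v_add_less:
  assumes "ev g \<noteq> 0" "ev h \<noteq> 0" "v g < v h"
  shows "ev (g + h) \<noteq> 0 \<and> v (g + h) = v g"
proof -
  have swap: "ev (g + h) = 0 \<Longrightarrow> ev g = ev h"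
    using fls_add_self[of "ev h"] by (metis add_right_cancel eval_fls_add)
  have nz: "ev (g + h) \<noteq> 0"
    using swap v_cong[of g h] assms by auto
  have eq: "ev (g + h + h) = ev g"
    by (simp only: eval_fls_add add.assoc fls_add_self add_0_right)
  have "v g = v (g + h + h)"
    using eq assms(1) by (intro v_cong) auto
  moreover have "min (v (g + h)) (v h) \<le> v (g + h + h)"
    using nz assms eq by (intro v_add) auto
  moreover have "min (v g) (v h) \<le> v (g + h)"
    using nz assms by (intro v_add) auto
  ultimately show ?thesis using nz assms(3) by auto
qed

lemma ev_coords_nonzero: "ev X_fn \<noteq> 0" "ev Y_fn \<noteq> 0" "ev (Z_fn n) \<noteq> 0" "ev (W_fn n) \<noteq> 0"
  using nonzero by (simp_all add: ev_simps ev_Z ev_W)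

lemma ev_power_nonzero: "ev g \<noteq> 0 \<Longrightarrow> ev (g ^ k) \<noteq> 0"
  by (simp add: ev_simps)

lemma ev_mult_nonzero: "ev g \<noteq> 0 \<Longrightarrow> ev h \<noteq> 0 \<Longrightarrow> ev (g * h) \<noteq> 0"
  by (simp add: ev_simps)

lemmas ev_nonzeros = ev_coords_nonzero ev_power_nonzero ev_mult_nonzero

lemma v_add_nonneg: "ev g \<noteq> 0 \<Longrightarrow> ev h \<noteq> 0 \<Longrightarrow> ev (g + h) \<noteq> 0 \<Longrightarrow> v g \<ge> 0 \<Longrightarrow> v h \<ge> 0 \<Longrightarrow> v (g + h) \<ge> 0"
  using v_add[of g h] by linarith

lemma q0_ge2: "int (q0 n) \<ge> 2"
proof -
  have "2 \<le> q0 n" using n power_increasing[of 1 n "2::nat"] by (simp add: q0_def)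
  thus ?thesis by linarith
qed

lemma qq_gt1: "int (qq n) > int (q0 n)" "int (qq n) > 1"
proof -
  have "1 * int (q0 n) < 2 * int (q0 n) * int (q0 n)"
    using q0_ge2 by (intro mult_strict_right_mono) auto
  thus "int (qq n) > int (q0 n)" by (simp add: qq_eq)
  thus "int (qq n) > 1" using q0_ge2 by linarith
qed

lemma ev_suzuki_eq:
  "ev (Y_fn ^ qq n + Y_fn) = ev (X_fn ^ (q0 n + qq n) + X_fn ^ (q0 n + 1))"
proof -
  have "0 = ev (Y_fn ^ qq n + Y_fn) + ev (X_fn ^ (q0 n + qq n) + X_fn ^ (q0 n + 1))"
    using ev_suzuki_poly unfolding suzuki_poly_alt pp_minus[OF char] by (simp only: eval_fls_add)
  thus ?thesis
    using fls_add_self[of "ev (X_fn ^ (q0 n + qq n) + X_fn ^ (q0 n + 1))"]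
    by (metis add_right_cancel)
qed

lemma ev_rhs_nonzero: "ev (X_fn ^ (q0 n + qq n) + X_fn ^ (q0 n + 1)) \<noteq> 0"
proof -
  have "fls_subdegree (x ^ (q0 n + qq n)) < fls_subdegree (x ^ (q0 n + 1))"
    using qq_gt1 by (simp add: fls_subdegree_pow subdegree_coords del: power_Suc power_add)
  hence "fls_subdegree (x ^ (q0 n + qq n) + x ^ (q0 n + 1)) < 0"
    using nonzero qq_gt1 q0_ge2
    by (subst fls_subdegree_add_eq1)
       (auto simp: fls_subdegree_pow subdegree_coords mult_less_0_iff simp del: power_Suc)
  hence "x ^ (q0 n + qq n) + x ^ (q0 n + 1) \<noteq> 0" by auto
  thus ?thesis by (simp only: ev_simps not_False_eq_True)
qed

lemma v_suzuki_eq: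
  "v (Y_fn ^ qq n + Y_fn) = v (X_fn ^ (q0 n + qq n) + X_fn ^ (q0 n + 1))"
  by (rule v_cong[OF ev_rhs_nonzero ev_suzuki_eq[symmetric]])

lemma v_Y_neg:
  assumes "v Y_fn < 0"
  shows "v (Y_fn ^ qq n + Y_fn) = int (qq n) * v Y_fn"
proof -
  have "v (Y_fn ^ qq n) < v Y_fn"
    using mult_strict_right_mono_neg[of 1 "int (qq n)" "v Y_fn"] qq_gt1(2) assms
    by (simp add: v_power ev_nonzeros)
  thus ?thesis
    using v_add_less[of "Y_fn ^ qq n" Y_fn] by (simp add: v_power ev_nonzeros)
qed

text \<open>A pole of y would make y^q dominate one side of the curve equation while the other side
  is regular; z and w are polynomials in x and y.\<close>

lemma v_finite:
  assumes "v X_fn \<ge> 0"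
  shows "v Y_fn \<ge> 0" "v (Z_fn n) \<ge> 0" "v (W_fn n) \<ge> 0"
proof -
  show Y: "v Y_fn \<ge> 0"
  proof (rule ccontr)
    assume "\<not> v Y_fn \<ge> 0"
    hence neg: "v Y_fn < 0" by simp
    have "v (X_fn ^ (q0 n + qq n) + X_fn ^ (q0 n + 1)) \<ge> 0"
      using assms by (intro v_add_nonneg ev_rhs_nonzero) (simp_all add: v_power ev_nonzeros del: power_Suc)
    thus False
      using v_Y_neg[OF neg] neg qq_gt1(2) unfolding v_suzuki_eq
      by (simp add: zero_le_mult_iff)
  qed
  show Z: "v (Z_fn n) \<ge> 0"
    unfolding Z_fn_def using assms Y
    by (intro v_add_nonneg ev_coords_nonzero[unfolded Z_fn_def])
       (simp_all add: v_power ev_nonzeros del: power_Suc)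
  show "v (W_fn n) \<ge> 0"
    unfolding W_fn_def using assms Y Z
    by (intro v_add_nonneg ev_coords_nonzero[unfolded W_fn_def])
       (simp_all add: v_power v_mult ev_nonzeros)
qed

text \<open>At a pole of x each relation has one dominant term, which gives q v(y) = (q + q0) v(x),
  q0 v(z) = (q0 + 1) v(x) and q0 v(w) = q0 v(x) + v(y). These fix the ratios of the values.\<close>

lemma v_infinite:
  assumes neg: "v X_fn < 0"
  obtains m where "m < 0" "v X_fn = int (qq n) * m" "v Y_fn = int (qq n + q0 n) * m"
    "v (Z_fn n) = int (qq n + 2 * q0 n) * m" "v (W_fn n) = int (qq n + 2 * q0 n + 1) * m"
proof -
  define r where "r = int (q0 n)"
  have r: "r \<ge> 2" using q0_ge2 by (simp add: r_def)
  have q: "int (qq n) = 2 * r * r" by (simp add: r_def qq_eq)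
  define a b c d where "a = v X_fn" and "b = v Y_fn" and "c = v (Z_fn n)" and "d = v (W_fn n)"
  have a: "a < 0" using neg by (simp add: a_def)
  have rhs: "v (X_fn ^ (q0 n + qq n) + X_fn ^ (q0 n + 1)) = (r + 2 * r * r) * a"
  proof -
    have "int (q0 n + qq n) * a < int (q0 n + 1) * a"
      using a qq_gt1(2) by (intro mult_strict_right_mono_neg) auto
    hence "v (X_fn ^ (q0 n + qq n)) < v (X_fn ^ (q0 n + 1))"
      by (simp only: v_power[OF ev_coords_nonzero(1)] a_def)
    from v_add_less[OF _ _ this] show ?thesis
      by (simp add: v_power ev_nonzeros a_def q r_def del: power_Suc)
  qed
  have "b < 0"
  proof (rule ccontr)
    assume "\<not> b < 0"
    hence "v (Y_fn ^ qq n + Y_fn) \<ge> 0"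
      using ev_rhs_nonzero ev_suzuki_eq
      by (intro v_add_nonneg) (simp_all add: v_power ev_nonzeros b_def del: power_Suc)
    hence "(r + 2 * r * r) * a \<ge> 0" by (simp only: v_suzuki_eq rhs)
    moreover have "(r + 2 * r * r) * a < 0"
      using a r by (intro mult_pos_neg) (auto intro: add_pos_pos)
    ultimately show False by simp
  qed
  hence "2 * r * r * b = (r + 2 * r * r) * a"
    using v_Y_neg rhs v_suzuki_eq by (simp add: b_def q)
  hence "r * (2 * r * b) = r * ((2 * r + 1) * a)" by (simp add: algebra_simps)
  hence b: "2 * r * b = (2 * r + 1) * a" using r by simp
  have rr: "2 * r \<le> r * r" using r by (intro mult_right_mono) auto
  have c: "r * c = (r + 1) * a"
  proof -
    \<comment> \<open>\<open>b\<close> is known only through \<open>2 * r * b\<close>, so the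
      comparison is made after multiplying.\<close>
    have "2 * r * ((r + 1) * a) < 2 * r * b"
    proof -
      have "(2 * (r * r) + 2 * r) * a < (2 * r + 1) * a"
        using a r rr by (intro mult_strict_right_mono_neg) linarith+
      thus ?thesis unfolding b by (simp add: algebra_simps)
    qed
    hence "(r + 1) * a < b" using r by simp
    hence "v (X_fn ^ (q0 n + 1)) < v Y_fn"
      by (simp only: v_power[OF ev_coords_nonzero(1)]) (simp add: a_def b_def r_def add.commute)
    hence *: "v (X_fn ^ (q0 n + 1) + Y_fn) = (r + 1) * a"
      using v_add_less[of "X_fn ^ (q0 n + 1)" Y_fn]
      by (simp add: v_power ev_nonzeros a_def r_def del: power_Suc)
    have "ev (Z_fn n ^ q0 n) = ev (X_fn ^ (q0 n + 1) + Y_fn)"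
      by (simp only: ev_simps ev_Z relations add.commute)
    from v_cong[OF _ this] show ?thesis
      using * by (simp add: v_power ev_nonzeros c_def r_def)
  qed
  have d: "r * d = r * a + b"
  proof -
    have "2 * r * (r * a + b) = (2 * (r * r) + 2 * r + 1) * a"
      using b by (simp add: algebra_simps)
    also have "\<dots> < (2 * r + 2) * a"
      using a r rr by (intro mult_strict_right_mono_neg) linarith+
    also have "\<dots> = 2 * r * c"
      using c by (simp add: algebra_simps)
    finally have "r * a + b < c" using r by simp
    hence "v (X_fn ^ q0 n * Y_fn) < v (Z_fn n)"
      by (simp add: v_mult v_power ev_nonzeros a_def b_def c_def r_def)
    hence *: "v (X_fn ^ q0 n * Y_fn + Z_fn n) = r * a + b"
      using v_add_less[of "X_fn ^ q0 n * Y_fn" "Z_fn n"]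
      by (simp add: v_mult v_power ev_nonzeros a_def b_def r_def)
    have "ev (W_fn n ^ q0 n) = ev (X_fn ^ q0 n * Y_fn + Z_fn n)"
      by (simp only: ev_simps ev_Z ev_W relations add.commute)
    from v_cong[OF _ this] show ?thesis
      using * by (simp add: v_power ev_nonzeros d_def r_def)
  qed
  \<comment> \<open>The common factor is an integer combination of the four values: \<open>e\<close>
    is 2 q0 m, \<open>f\<close> is q0 m, and \<open>m\<close> is what remains of
    \<open>d\<close>.\<close>
  define e where "e = c - a"
  have ae: "a = r * e" using c by (simp add: e_def algebra_simps)
  have "r * (2 * b) = r * ((2 * r + 1) * e)"
    using b by (simp add: ae algebra_simps)
  hence "2 * b = (2 * r + 1) * e" using r by simp
  define f where "f = b - r * e"
  have ef: "e = 2 * f"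
    using \<open>2 * b = (2 * r + 1) * e\<close> by (simp add: f_def algebra_simps)
  define m where "m = d - a - 2 * f"
  have "b = f + r * e" by (simp add: f_def)
  hence bf: "b = (2 * r + 1) * f" unfolding ef by (simp add: algebra_simps)
  have fm: "f = r * m"
    using d by (simp add: m_def ae ef bf algebra_simps)
  have am: "a = 2 * r * r * m" by (simp add: ae ef fm)
  have "m < 0"
  proof (rule ccontr)
    assume "\<not> m < 0"
    hence "2 * r * r * m \<ge> 0" using r by simp
    thus False using a am by simp
  qed
  moreover have "b = (2 * r * r + r) * m" by (simp add: bf fm algebra_simps)
  moreover have "c = (2 * r * r + 2 * r) * m"
    using e_def by (simp add: am ef fm algebra_simps)
  moreover have "d = (2 * r * r + 2 * r + 1) * m"
    using m_def by (simp add: am fm algebra_simps)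
  ultimately show ?thesis
    using am that[of m] unfolding a_def b_def c_def d_def
    by (simp add: q flip: r_def)
qed

text \<open>On monomials v is proportional to the subdegree. For general g, subtracting a scaled
  monomial of the same pole order leaves a smaller pole order, hence by induction a strictly larger
  value, so g has the value of that monomial.\<close>

lemma v_eq_subdegree:
  assumes neg: "v X_fn < 0" and g: "ev g \<noteq> 0"
  shows "v g = fls_subdegree (ev g)"
proof -
  obtain m where m: "m < 0" "v X_fn = int (qq n) * m" "v Y_fn = int (qq n + q0 n) * m"
    "v (Z_fn n) = int (qq n + 2 * q0 n) * m" "v (W_fn n) = int (qq n + 2 * q0 n + 1) * m"
    by (rule v_infinite[OF neg])
  have mon: "v (mon_fn n i a b c) = m * mon_wt n (int i) (int a) (int b) (int c)" for i a b c
    unfolding mon_fn_def mon_wt_def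
    by (simp add: v_mult v_power ev_nonzeros m algebra_simps)
  have scaled: "v g = - m * fls_subdegree (ev g)" if "ev g \<noteq> 0" for g
    using that
  proof (induction "nat (- fls_subdegree (ev g))" arbitrary: g rule: less_induct)
    case less
    have "- fls_subdegree (ev g) \<in> pole_semigroup n"
      by (rule ev_pole[OF less.prems])
    then obtain i a b d where "- fls_subdegree (ev g) = mon_wt n (int i) (int a) (int b) (int d)"
      unfolding pole_semigroup_def by blast
    define h :: "'a poly poly" where "h = mon_fn n i a b d"
    have h: "ev h \<noteq> 0" "fls_subdegree (ev g) = fls_subdegree (ev h)" "v h = - m * fls_subdegree (ev h)"
      using \<open>- fls_subdegree (ev g) = _\<close>
      by (simp_all add: h_def ev_mon_nonzero) (simp_all add: ev_mon subdegree_mon mon)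
    obtain c where c: "c \<noteq> 0" "ev g = fls_const c * ev h \<or>
        ev g - fls_const c * ev h \<noteq> 0 \<and> fls_subdegree (ev g - fls_const c * ev h) > fls_subdegree (ev h)"
      by (rule fls_subdegree_sub_scale[OF less.prems h(1,2)])
    define h' where "h' = [:[:c:]:] * h"
    have evh': "ev h' = fls_const c * ev h"
      by (simp only: h'_def ev_simps)
    have h': "ev h' \<noteq> 0" "v h' = v h"
      using c(1) h(1) v_mult[of "[:[:c:]:]" h]
      by (simp add: evh', simp add: h'_def ev_simps v_const)
    show ?case
      using c(2) unfolding evh'[symmetric]
    proof
      assume "ev g = ev h'"
      hence "v g = v h'" using h'(1) v_cong by metis
      thus ?thesis by (simp only: h' h)
    next
      assume *: "ev g - ev h' \<noteq> 0 \<and> fls_subdegree (ev h) < fls_subdegree (ev g - ev h')"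
      have gh: "ev (g - h') \<noteq> 0" "fls_subdegree (ev g) < fls_subdegree (ev (g - h'))"
        using * h(2) by (simp_all add: ev_simps)
      have "- fls_subdegree (ev (g - h')) \<ge> 0"
        by (rule pole_semigroup_nonneg[OF ev_pole[OF gh(1)]])
      hence "v (g - h') = - m * fls_subdegree (ev (g - h'))"
        using gh by (intro less.hyps) auto
      also have "\<dots> > - m * fls_subdegree (ev g)"
        using gh(2) m(1) by simp
      also have "- m * fls_subdegree (ev g) = v h'"
        by (simp only: h' h)
      finally have "v (h' + (g - h')) = v h'"
        using v_add_less[OF h'(1) gh(1)] by simp
      thus ?thesis by (simp add: h' h)
    qed
  qed
  \<comment> \<open>Some difference of values is 1, so the negative integer \<open>m\<close> divides
    1; this pins the scale.\<close>
  obtain g1 g2 where g12: "ev g1 \<noteq> 0" "ev g2 \<noteq> 0" "v g1 - v g2 = 1"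
    using v_normalized by blast
  have "1 = m * (fls_subdegree (ev g2) - fls_subdegree (ev g1))"
    using g12(3) scaled[OF g12(1)] scaled[OF g12(2)] by (simp add: algebra_simps)
  hence "m dvd 1" by (rule dvdI)
  hence "m = -1" using m(1) by (simp add: zdvd1_eq)
  thus ?thesis using scaled[OF g] by simp
qed

end

context suzuki_branch
begin

text \<open>The bound concerns every place: \<open>v_finite\<close> treats those where x is regular,
  \<open>v_eq_subdegree\<close> those where x has a pole.\<close>

lemma coords_in_riemann_roch:
  fixes g :: "'a poly poly"
  assumes "g \<in> {1, X_fn, Y_fn, Z_fn n, W_fn n}"
  shows "(g, 1) \<in> riemann_roch n (emb_degree n)"
proof -
  have "(if v X_fn < 0 then - int (emb_degree n) else 0) \<le> v g - v 1" if v: "is_place n v" for v :: "'a poly poly \<Rightarrow> int"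
  proof -
    interpret suzuki_place n x y z w v
      by unfold_locales (rule v)
    show ?thesis
    proof (cases "v X_fn < 0")
      case True
      have "v g = fls_subdegree (ev g)"
        using assms ev_coords_nonzero by (intro v_eq_subdegree[OF True]) (auto simp: ev_simps)
      also have "\<dots> \<ge> - int (emb_degree n)"
        using assms by (auto simp: ev_simps ev_Z ev_W subdegree_coords emb_degree_def)
      finally show ?thesis using True by (simp add: v_1)
    next
      case False
      thus ?thesis using assms v_finite by (auto simp: v_1)
    qed
  qed
  thus ?thesis
    by (auto simp: riemann_roch_def dvd_iff_ev ev_simps)
qed

end

section \<open>Evaluation of forms\<close>

lemma fls_times_in_span:
  fixes u v :: "'a::field fls"
  assumes "u \<in> fls.span A" "v \<in> fls.span B"
  shows "u * v \<in> fls.span (A * B)"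
proof -
  have 1: "a * v \<in> fls.span (A * B)" if a: "a \<in> A" for a
    using assms(2)
  proof (induction rule: fls.span_induct_alt)
    case (step c b v)
    have "a * (fls_const c * b + v) = fls_const c * (a * b) + a * v"
      by (simp add: algebra_simps)
    also have "\<dots> \<in> fls.span (A * B)"
    proof (intro fls.span_add fls.span_scale)
      show "a * b \<in> fls.span (A * B)"
        using a step.hyps by (intro fls.span_base set_times_intro)
    qed (rule step.IH)
    finally show ?case .
  qed (simp add: fls.span_zero)
  show ?thesis
    using assms(1)
  proof (induction rule: fls.span_induct_alt)
    case (step c a u)
    have "(fls_const c * a + u) * v = fls_const c * (a * v) + u * v"
      by (simp add: algebra_simps)
    also have "\<dots> \<in> fls.span (A * B)"
      using 1 step by (intro fls.span_add fls.span_scale)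
    finally show ?case .
  qed (simp add: fls.span_zero)
qed

lemma fls_power_subset_span:
  fixes A B :: "'a::field fls set"
  assumes "A \<subseteq> fls.span B"
  shows "A ^ t \<subseteq> fls.span (B ^ t)"
proof (induction t)
  case 0
  show ?case by (auto intro: fls.span_base)
next
  case (Suc t)
  show ?case
    using Suc assms by (auto elim!: set_times_elim intro!: fls_times_in_span)
qed

text \<open>\<open>A ^ t\<close> is the set of t-fold products. A linear change of coordinates thus
  does not affect the space of functions given by forms of degree t.\<close>

lemma fls_span_power_cong:
  fixes A B :: "'a::field fls set"
  assumes "fls.span A = fls.span B"
  shows "fls.span (A ^ t) = fls.span (B ^ t)"
proof
  have "A \<subseteq> fls.span B" "B \<subseteq> fls.span A"
    using assms fls.span_superset[of A] fls.span_superset[of B] by auto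
  thus "fls.span (A ^ t) \<subseteq> fls.span (B ^ t)" and "fls.span (B ^ t) \<subseteq> fls.span (A ^ t)"
    by (simp_all add: fls.span_minimal fls_power_subset_span)
qed

lemma power_in_set_power: "u \<in> A \<Longrightarrow> u ^ m \<in> (A :: 'b::comm_monoid_mult set) ^ m"
  by (induction m) (auto intro: set_times_intro)

lemma prod_power_in_set_power:
  fixes A :: "'b::comm_monoid_mult set" and k :: nat
  assumes "\<And>i. i < k \<Longrightarrow> p i \<in> A"
  shows "(\<Prod>i<k. p i ^ e i) \<in> A ^ (\<Sum>i<k. e i)"
  using assms
proof (induction k)
  case (Suc k)
  thus ?case
    by (auto simp: power_add intro!: set_times_intro power_in_set_power)
qed auto

lemma set_power_eq_monomials:
  fixes p :: "nat \<Rightarrow> 'b::comm_monoid_mult"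
  shows "(p ` {..<5}) ^ t = (\<lambda>e. \<Prod>i<5. p i ^ (e ! i)) ` monoms t"
proof (intro equalityI subsetI)
  fix u assume "u \<in> (\<lambda>e. \<Prod>i<5. p i ^ (e ! i)) ` monoms t"
  then obtain e where e: "length e = 5" "sum_list e = t" "u = (\<Prod>i<5. p i ^ (e ! i))"
    by (auto simp: monoms_def)
  have "t = (\<Sum>i<5. e ! i)"
    using e by (simp add: sum_list_sum_nth atLeast0LessThan)
  thus "u \<in> (p ` {..<5}) ^ t"
    unfolding e(3) using prod_power_in_set_power[of 5 p "p ` {..<5}" "(!) e"] by simp
next
  fix u assume "u \<in> (p ` {..<5}) ^ t"
  thus "u \<in> (\<lambda>e. \<Prod>i<5. p i ^ (e ! i)) ` monoms t"
  proof (induction t arbitrary: u)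
    case 0
    thus ?case
      by (intro image_eqI[of _ _ "replicate 5 0"]) (auto simp: monoms_def)
  next
    case (Suc t)
    then obtain j u' where j: "j < 5" "u = p j * u'" "u' \<in> (p ` {..<5}) ^ t"
      by (auto elim!: set_times_elim)
    obtain e where e: "e \<in> monoms t" "u' = (\<Prod>i<5. p i ^ (e ! i))"
      using Suc.IH[OF j(3)] by blast
    define e' where "e' = e[j := Suc (e ! j)]"
    have "e' \<in> monoms (Suc t)"
      using e(1) j(1) by (auto simp: monoms_def e'_def sum_list_update elem_le_sum_list)
    moreover have "(\<Prod>i<5. p i ^ (e' ! i)) = u"
    proof -
      have "(\<Prod>i<5. p i ^ (e' ! i)) = p j ^ (e' ! j) * (\<Prod>i\<in>{..<5}-{j}. p i ^ (e' ! i))"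
        using j(1) by (intro prod.remove) auto
      also have "(\<Prod>i\<in>{..<5}-{j}. p i ^ (e' ! i)) = (\<Prod>i\<in>{..<5}-{j}. p i ^ (e ! i))"
        by (intro prod.cong) (auto simp: e'_def)
      also have "p j ^ (e' ! j) = p j * p j ^ (e ! j)"
        using e(1) j(1) by (simp add: e'_def monoms_def)
      also have "p j * p j ^ (e ! j) * (\<Prod>i\<in>{..<5}-{j}. p i ^ (e ! i)) = p j * u'"
        unfolding e(2) mult.assoc using j(1) by (subst prod.remove[of "{..<5}" j]) auto
      finally show ?thesis by (simp add: j(2))
    qed
    ultimately show ?case by blast
  qed
qed

section \<open>The space of forms and its evaluation map\<close>

global_interpretation forms: vector_space "\<lambda>(a::'a::field) (P :: nat list \<Rightarrow> 'a). \<lambda>e. a * P e"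
  by unfold_locales (auto simp: fun_eq_iff algebra_simps)

lemma card_monoms: "card (monoms t) = (t + 4) choose 4"
proof -
  have "card (monoms t) = (t + 5 - 1) choose t"
    unfolding monoms_def by (rule card_length_sum_list)
  also have "t + 5 - 1 = t + 4" by simp
  also have "(t + 4) choose t = (t + 4) choose 4"
    using binomial_symmetric[of 4 "t + 4"] by simp
  finally show ?thesis .
qed

lemma sum_fun_apply: "sum f A x = (\<Sum>a\<in>A. f a x)"
  by (induction A rule: infinite_finite_induct) (simp_all add: plus_fun_def)

lemma finite_monoms: "finite (monoms t)"
  using card_monoms[of t] by (intro card_ge_0_finite) simp

lemma subspace_hom_polys: "forms.subspace (hom_polys t)"
  unfolding forms.subspace_def hom_polys_def by (auto simp: plus_fun_def) (metis add_0)

definition delta_form :: "nat list \<Rightarrow> nat list \<Rightarrow> 'a::field" where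
  "delta_form e = (\<lambda>e'. if e' = e then 1 else 0)"

lemma hom_polys_eq_span: "(hom_polys t :: (nat list \<Rightarrow> 'a::field) set) = forms.span (delta_form ` monoms t)"
proof
  show "forms.span (delta_form ` monoms t :: (nat list \<Rightarrow> 'a) set) \<subseteq> hom_polys t"
    by (rule forms.span_minimal[OF _ subspace_hom_polys])
       (auto simp: hom_polys_def delta_form_def split: if_splits)
next
  show "(hom_polys t :: (nat list \<Rightarrow> 'a) set) \<subseteq> forms.span (delta_form ` monoms t)"
  proof
    fix P :: "nat list \<Rightarrow> 'a" assume P: "P \<in> hom_polys t"
    have eq: "P = (\<Sum>e\<in>monoms t. (\<lambda>e'. P e * delta_form e e'))"
      using P finite_monoms[of t]
      by (auto simp: fun_eq_iff sum_fun_apply delta_form_def hom_polys_def if_distrib cong: if_cong)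
    show "P \<in> forms.span (delta_form ` monoms t)"
      by (subst eq, intro forms.span_sum forms.span_scale forms.span_base) auto
  qed
qed

lemma dim_hom_polys: "forms.dim (hom_polys t :: (nat list \<Rightarrow> 'a::field) set) = (t + 4) choose 4"
proof -
  have inj: "inj_on (delta_form :: nat list \<Rightarrow> nat list \<Rightarrow> 'a) (monoms t)"
    by (rule inj_onI) (auto simp: delta_form_def fun_eq_iff split: if_splits)
  have "forms.independent (delta_form ` monoms t :: (nat list \<Rightarrow> 'a) set)"
  proof (rule forms.independent_if_scalars_zero)
    fix f :: "(nat list \<Rightarrow> 'a) \<Rightarrow> 'a" and P :: "nat list \<Rightarrow> 'a"
    assume *: "(\<Sum>P\<in>delta_form ` monoms t. (\<lambda>e. f P * P e)) = 0" "P \<in> delta_form ` monoms t"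
    then obtain e where e: "e \<in> monoms t" "P = delta_form e" by blast
    have "(\<Sum>e'\<in>monoms t. f (delta_form e') * delta_form e' e) = 0"
      using fun_cong[OF *(1), of e] inj by (simp add: sum_fun_apply sum.reindex)
    thus "f P = 0"
      using e finite_monoms[of t] by (simp add: delta_form_def if_distrib cong: if_cong)
  qed (simp add: finite_monoms)
  thus ?thesis
    using inj card_monoms[of t] unfolding hom_polys_eq_span
    by (simp add: forms.dim_eq_card_independent card_image)
qed

definition form_value :: "(nat \<Rightarrow> 'a::field fls) \<Rightarrow> nat \<Rightarrow> (nat list \<Rightarrow> 'a) \<Rightarrow> 'a fls" where
  "form_value p t P = (\<Sum>e\<in>monoms t. fls_const (P e) * (\<Prod>i<5. p i ^ (e ! i)))"

lemma form_value_linear: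
  "Vector_Spaces.linear (\<lambda>(a::'a::field) P. \<lambda>e. a * P e) (\<lambda>c u. fls_const c * u) (form_value p t)"
  by unfold_locales
     (auto simp: form_value_def sum_distrib_left algebra_simps sum.distrib simp flip: fls_plus_const)

lemma form_value_image:
  "form_value p t ` hom_polys t = fls.span ((p ` {..<5}) ^ t)"
proof -
  interpret vector_space_pair "\<lambda>(a::'a::field) (P :: nat list \<Rightarrow> 'a). \<lambda>e. a * P e"
      "\<lambda>(c::'a) u. fls_const c * u" ..
  have "form_value p t (delta_form e) = (\<Prod>i<5. p i ^ (e ! i))" if "e \<in> monoms t" for e
  proof -
    have "form_value p t (delta_form e) = (\<Sum>e'\<in>monoms t. if e' = e then \<Prod>i<5. p i ^ (e ! i) else 0)"
      unfolding form_value_def by (intro sum.cong) (auto simp: delta_form_def)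
    thus ?thesis using that finite_monoms by simp
  qed
  hence "form_value p t ` delta_form ` monoms t = (p ` {..<5}) ^ t"
    unfolding set_power_eq_monomials image_image by (intro image_cong) auto
  thus ?thesis
    unfolding hom_polys_eq_span linear_span_image[OF form_value_linear, symmetric] by simp
qed

text \<open>Rank-nullity for evaluation at \<open>p\<close>. When \<open>p\<close> is the embedding
  along the branch, the kernel consists of the forms vanishing on the curve.\<close>

lemma dim_form_value_kernel:
  fixes p :: "nat \<Rightarrow> 'a::field fls"
  shows "fls.dim (fls.span ((p ` {..<5}) ^ t)) + forms.dim {P \<in> hom_polys t. form_value p t P = 0}
     = (t + 4) choose 4"
proof -
  interpret vector_space_pair "\<lambda>(a::'a::field) (P :: nat list \<Rightarrow> 'a). \<lambda>e. a * P e"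
      "\<lambda>(c::'a) u. fls_const c * u" ..
  show ?thesis
    using dim_image_plus_dim_kernel[OF form_value_linear[of p t] subspace_hom_polys[of t],
      of "delta_form ` monoms t"]
    by (simp add: form_value_image dim_hom_polys finite_monoms hom_polys_eq_span[symmetric])
qed

section \<open>The dimension count\<close>

context suzuki_branch
begin

definition coords :: "'a fls set" where "coords = {1, x, y, z, w}"

lemma coords_power: "coords ^ t = {x ^ i * y ^ a * z ^ b * w ^ c | i a b c. i + a + b + c \<le> t}"
proof (intro equalityI subsetI)
  fix u assume "u \<in> coords ^ t"
  thus "u \<in> {x ^ i * y ^ a * z ^ b * w ^ c | i a b c. i + a + b + c \<le> t}"
  proof (induction t arbitrary: u)
    case 0
    thus ?case by auto
  next
    case (Suc t)
    then obtain s u' where su: "s \<in> coords" "u' \<in> coords ^ t" "u = s * u'"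
      by (auto elim!: set_times_elim)
    obtain i a b c where u': "u' = x ^ i * y ^ a * z ^ b * w ^ c" "i + a + b + c \<le> t"
      using Suc.IH[OF su(2)] by blast
    have "\<exists>i' a' b' c'. i' + a' + b' + c' \<le> Suc (i + a + b + c) \<and> u = x ^ i' * y ^ a' * z ^ b' * w ^ c'"
    proof -
      consider "s = 1" | "s = x" | "s = y" | "s = z" | "s = w"
        using su(1) by (auto simp: coords_def)
      thus ?thesis
      proof cases
        case 1
        show ?thesis by (rule exI[of _ i], rule exI[of _ a], rule exI[of _ b], rule exI[of _ c]) (simp add: su u' 1)
      next
        case 2
        show ?thesis by (rule exI[of _ "Suc i"], rule exI[of _ a], rule exI[of _ b], rule exI[of _ c]) (simp add: su u' 2)
      next
        case 3
        show ?thesis by (rule exI[of _ i], rule exI[of _ "Suc a"], rule exI[of _ b], rule exI[of _ c]) (simp add: su u' 3)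
      next
        case 4
        show ?thesis by (rule exI[of _ i], rule exI[of _ a], rule exI[of _ "Suc b"], rule exI[of _ c]) (simp add: su u' 4)
      next
        case 5
        show ?thesis by (rule exI[of _ i], rule exI[of _ a], rule exI[of _ b], rule exI[of _ "Suc c"]) (simp add: su u' 5)
      qed
    qed
    thus ?case using u'(2) by fastforce
  qed
next
  fix u assume "u \<in> {x ^ i * y ^ a * z ^ b * w ^ c | i a b c. i + a + b + c \<le> t}"
  then obtain i a b c where u: "u = x ^ i * y ^ a * z ^ b * w ^ c" "i + a + b + c \<le> t"
    by blast
  \<comment> \<open>Factors 1 fill the product up to exactly t factors.\<close>
  define d where "d = t - (i + a + b + c)"
  have t: "t = d + (i + a + b + c)" using u(2) by (simp add: d_def)
  have "1 ^ d * (x ^ i * y ^ a * z ^ b * w ^ c) \<in> coords ^ t"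
    unfolding t power_add by (intro set_times_intro power_in_set_power) (simp_all add: coords_def)
  thus "u \<in> coords ^ t" by (simp add: u(1))
qed

lemma ev_snd_basis_nonzero:
  assumes "is_L_basis n \<phi>" "i < 5"
  shows "ev (snd (\<phi> i)) \<noteq> 0"
proof -
  have "\<phi> i \<in> riemann_roch n (emb_degree n)"
    using assms by (simp add: is_L_basis_def)
  thus ?thesis
    by (cases "\<phi> i") (simp add: riemann_roch_def dvd_iff_ev)
qed

text \<open>The basis property puts 1, x, y, z, w into the span of the \<open>p i\<close>; being
  five independent vectors in a space spanned by five, they span all of it.\<close>

lemma span_basis_eq_span_coords:
  fixes \<phi> :: "nat \<Rightarrow> 'a poly poly \<times> 'a poly poly"
  assumes basis: "is_L_basis n \<phi>"
  defines "p \<equiv> \<lambda>i. ev (fst (\<phi> i)) / ev (snd (\<phi> i))"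
  shows "fls.span (p ` {..<5}) = fls.span coords"
proof -
  note snd_nz = ev_snd_basis_nonzero[OF basis]
  have "ev g \<in> fls.span (p ` {..<5})" if g: "g \<in> {1, X_fn, Y_fn, Z_fn n, W_fn n}" for g :: "'a poly poly"
  proof -
    obtain c where c: "ff_eq n (g, 1) (lincomb c \<phi>)"
      using basis coords_in_riemann_roch[OF g] by (auto simp: is_L_basis_def)
    \<comment> \<open>The common denominator used in \<open>lincomb\<close>.\<close>
    define H where "H = (\<Prod>j<5. ev (snd (\<phi> j)))"
    have H: "H \<noteq> 0" using snd_nz by (auto simp: H_def)
    have "ev g * H = (\<Sum>i<5. fls_const (c i) * ev (fst (\<phi> i)) * (\<Prod>j\<in>{..<5}-{i}. ev (snd (\<phi> j))))"
      using c unfolding ff_eq_def lincomb_def dvd_iff_ev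
      by (simp add: ev_simps eval_fls_sum eval_fls_prod H_def del: mult_pCons_left)
    also have "\<dots> = (\<Sum>i<5. fls_const (c i) * p i * H)"
    proof (rule sum.cong)
      fix i assume i: "i \<in> {..<5::nat}"
      have "H = ev (snd (\<phi> i)) * (\<Prod>j\<in>{..<5}-{i}. ev (snd (\<phi> j)))"
        unfolding H_def using i by (intro prod.remove) auto
      thus "fls_const (c i) * ev (fst (\<phi> i)) * (\<Prod>j\<in>{..<5}-{i}. ev (snd (\<phi> j))) = fls_const (c i) * p i * H"
        using snd_nz[of i] i by (simp add: p_def)
    qed simp
    also have "\<dots> = (\<Sum>i<5. fls_const (c i) * p i) * H"
      by (simp add: sum_distrib_right)
    finally have "ev g = (\<Sum>i<5. fls_const (c i) * p i)"
      using H by simp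
    thus ?thesis
      by (auto intro!: fls.span_sum fls.span_scale intro: fls.span_base)
  qed
  from this[of 1] this[of X_fn] this[of Y_fn] this[of "Z_fn n"] this[of "W_fn n"]
  have sub: "coords \<subseteq> fls.span (p ` {..<5})"
    by (simp add: coords_def ev_simps ev_Z ev_W)
  have ne: "qq n > 0" "q0 n > 0" by (simp_all add: qq_def q0_def)
  have inj: "inj_on fls_subdegree coords"
    using ne by (auto simp: coords_def inj_on_def subdegree_coords)
  have indep: "fls.independent coords"
    using nonzero inj by (intro fls_independent_distinct_subdegree) (auto simp: coords_def)
  have "fls_subdegree ` coords = {0, - int (qq n), - int (qq n + q0 n), - int (qq n + 2 * q0 n), - int (qq n + 2 * q0 n + 1)}"
    by (simp add: coords_def subdegree_coords)
  hence "card coords = card {0, - int (qq n), - int (qq n + q0 n), - int (qq n + 2 * q0 n), - int (qq n + 2 * q0 n + 1)}"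
    using card_image[OF inj] by simp
  also have "\<dots> = 5" using ne by simp
  finally have card: "card coords = 5" .
  have "p ` {..<5} \<subseteq> fls.span coords"
  proof (rule ccontr)
    assume "\<not> p ` {..<5} \<subseteq> fls.span coords"
    then obtain i where i: "i < 5" "p i \<notin> fls.span coords" by auto
    have "fls.independent (insert (p i) coords)"
      by (rule fls.independent_insertI[OF i(2) indep])
    moreover have "insert (p i) coords \<subseteq> fls.span (p ` {..<5})"
      using i(1) sub by (auto intro: fls.span_base)
    ultimately have "card (insert (p i) coords) \<le> card (p ` {..<5})"
      using fls.independent_span_bound[of "p ` {..<5}"] by simp
    also have "\<dots> \<le> 5" using card_image_le[of "{..<5::nat}" p] by simp
    finally show False
      using card i(2) fls.span_base[of "p i" coords] by (auto simp: coords_def card_insert_if split: if_splits)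
  qed
  thus ?thesis
    using sub by (metis antisym fls.span_minimal fls.subspace_span)
qed

text \<open>\<open>eval_hom\<close> is the value of the form times the nonzero factor
  \<open>H ^ t\<close> that clears denominators.\<close>

lemma vanishing_forms_eq:
  fixes \<phi> :: "nat \<Rightarrow> 'a poly poly \<times> 'a poly poly"
  assumes basis: "is_L_basis n \<phi>"
  shows "vanishing_forms n \<phi> t
    = {P \<in> hom_polys t. form_value (\<lambda>i. ev (fst (\<phi> i)) / ev (snd (\<phi> i))) t P = 0}"
proof -
  define p where "p = (\<lambda>i. ev (fst (\<phi> i)) / ev (snd (\<phi> i)))"
  define H where "H = (\<Prod>j<5. ev (snd (\<phi> j)))"
  note snd_nz = ev_snd_basis_nonzero[OF basis]
  have H: "H \<noteq> 0" using snd_nz by (auto simp: H_def)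
  have "ev (eval_hom \<phi> t P) = H ^ t * form_value p t P" for P
  proof -
    have "(\<Prod>i<5. ev (fst (\<phi> i)) ^ (e ! i) * ev (snd (\<phi> i)) ^ (t - e ! i))
            = H ^ t * (\<Prod>i<5. p i ^ (e ! i))" if e: "e \<in> monoms t" for e
      unfolding H_def prod_power_distrib prod.distrib[symmetric]
    proof (rule prod.cong)
      fix i assume i: "i \<in> {..<5::nat}"
      have "e ! i \<le> t" using e i elem_le_sum_list[of i e] by (auto simp: monoms_def)
      hence "ev (snd (\<phi> i)) ^ t = ev (snd (\<phi> i)) ^ (e ! i) * ev (snd (\<phi> i)) ^ (t - e ! i)"
        by (simp flip: power_add)
      thus "ev (fst (\<phi> i)) ^ (e ! i) * ev (snd (\<phi> i)) ^ (t - e ! i) = ev (snd (\<phi> i)) ^ t * p i ^ (e ! i)"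
        using snd_nz[of i] i by (simp add: p_def power_divide)
    qed simp
    thus ?thesis
      unfolding eval_hom_def form_value_def sum_distrib_left eval_fls_sum
      by (intro sum.cong) (simp_all add: ev_simps eval_fls_prod mult.left_commute del: mult_pCons_left)
  qed
  thus ?thesis
    unfolding vanishing_forms_def dvd_iff_ev using H by (simp flip: p_def)
qed

lemma kappa_plus_dim:
  fixes \<phi> :: "nat \<Rightarrow> 'a poly poly \<times> 'a poly poly"
  assumes "is_L_basis n \<phi>"
  shows "kappa n \<phi> t + fls.dim (fls.span (coords ^ t)) = (t + 4) choose 4"
  using dim_form_value_kernel[of "\<lambda>i. ev (fst (\<phi> i)) / ev (snd (\<phi> i))" t]
    fls_span_power_cong[OF span_basis_eq_span_coords[OF assms], of t]
  by (simp add: kappa_def vanishing_forms_eq[OF assms] add.commute del: fls.dim_span)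

text \<open>With 1 as fifth coordinate, y^2 = x z + w is a quadric containing the curve.
  Substituting it does not raise the degree and lowers the exponent of y.\<close>

lemma reduce_y_power:
  "x ^ i * y ^ a * z ^ b * w ^ c
     \<in> fls.span {x ^ i' * y ^ a' * z ^ b' * w ^ c' | i' a' b' c'. a' < 2 \<and> i' + a' + b' + c' \<le> i + a + b + c}"
proof (induction a arbitrary: i b c rule: less_induct)
  case (less a)
  show ?case
  proof (cases "a < 2")
    case True
    thus ?thesis by (intro fls.span_base) blast
  next
    case False
    then obtain a' where a: "a = a' + 2" using le_Suc_ex[of 2 a] by auto
    let ?S = "\<lambda>d. {x ^ i' * y ^ a' * z ^ b' * w ^ c' | i' a' b' c'. a' < 2 \<and> i' + a' + b' + c' \<le> d}"
    have mono: "fls.span (?S d) \<subseteq> fls.span (?S d')" if "d \<le> d'" for d d'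
      using that by (intro fls.span_mono) force
    have "x ^ i * y ^ a * z ^ b * w ^ c
        = x ^ (i + 1) * y ^ a' * z ^ (b + 1) * w ^ c + x ^ i * y ^ a' * z ^ b * w ^ (c + 1)"
      by (simp only: a power_add relations) (simp add: algebra_simps)
    also have "\<dots> \<in> fls.span (?S (i + a + b + c))"
    proof (rule fls.span_add)
      show "x ^ (i + 1) * y ^ a' * z ^ (b + 1) * w ^ c \<in> fls.span (?S (i + a + b + c))"
        using less[of a' "i + 1" "b + 1" c] mono[of "i + 1 + a' + (b + 1) + c" "i + a + b + c"] a by auto
      show "x ^ i * y ^ a' * z ^ b * w ^ (c + 1) \<in> fls.span (?S (i + a + b + c))"
        using less[of a' i b "c + 1"] mono[of "i + a' + b + (c + 1)" "i + a + b + c"] a by auto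
    qed
    finally show ?thesis .
  qed
qed

text \<open>The monomials that remain after reduction by the quadric have distinct pole orders by
  \<open>mon_wt_inj_low_degree\<close>, so they satisfy no further relation: in these degrees the
  vanishing forms are the multiples of the quadric.\<close>

lemma dim_coords_power_small:
  assumes t: "t \<ge> 1" "t \<le> q0 n"
  shows "fls.dim (fls.span (coords ^ t)) = ((t + 3) choose 3) + ((t + 2) choose 3)"
proof -
  define Q where "Q = {(i, a, b, c). a < (2::nat) \<and> i + a + b + c \<le> t}"
  define m where "m = (\<lambda>(i, a, b, c). x ^ i * y ^ a * z ^ b * w ^ c)"
  have sub_m: "fls_subdegree (m (i, a, b, c)) = - mon_wt n (int i) (int a) (int b) (int c)" for i a b c
    by (simp add: m_def subdegree_mon)
  have inj': "inj_on (\<lambda>e. fls_subdegree (m e)) Q"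
  proof (rule inj_onI)
    fix e e' assume *: "e \<in> Q" "e' \<in> Q" "fls_subdegree (m e) = fls_subdegree (m e')"
    obtain i a b c where e: "e = (i, a, b, c)" by (rule prod_cases4)
    obtain i' a' b' c' where e': "e' = (i', a', b', c')" by (rule prod_cases4)
    show "e = e'"
      using mon_wt_inj_low_degree[OF t(2), of i a b c i' a' b' c'] * unfolding e e' sub_m
      by (auto simp: Q_def)
  qed
  hence inj: "inj_on m Q" "inj_on fls_subdegree (m ` Q)"
    by (auto simp: inj_on_def)
  have "0 \<notin> m ` Q" using nonzero by (auto simp: m_def)
  hence indep: "fls.independent (m ` Q)"
    by (rule fls_independent_distinct_subdegree[OF _ inj(2)])
  have mQ: "m ` Q = {x ^ i * y ^ a * z ^ b * w ^ c | i a b c. a < 2 \<and> i + a + b + c \<le> t}"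
    by (force simp: m_def Q_def)
  have "fls.span (coords ^ t) = fls.span (m ` Q)"
  proof
    have "coords ^ t \<subseteq> fls.span (m ` Q)"
    proof
      fix u assume "u \<in> coords ^ t"
      then obtain i a b c where u: "u = x ^ i * y ^ a * z ^ b * w ^ c" "i + a + b + c \<le> t"
        unfolding coords_power by blast
      have "fls.span {x ^ i' * y ^ a' * z ^ b' * w ^ c' | i' a' b' c'. a' < 2 \<and> i' + a' + b' + c' \<le> i + a + b + c}
          \<subseteq> fls.span (m ` Q)"
        unfolding mQ using u(2) by (intro fls.span_mono) force
      thus "u \<in> fls.span (m ` Q)"
        using reduce_y_power[of i a b c] u(1) by blast
    qed
    thus "fls.span (coords ^ t) \<subseteq> fls.span (m ` Q)"
      by (rule fls.span_minimal) simp
    show "fls.span (m ` Q) \<subseteq> fls.span (coords ^ t)"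
      unfolding mQ coords_power by (intro fls.span_mono) blast
  qed
  thus ?thesis
    using fls.dim_eq_card_independent[OF indep] card_image[OF inj(1)] card_low_degree[OF t(1)]
    by (simp add: Q_def)
qed

text \<open>One inclusion bounds pole orders by those of t-fold products and uses
  \<open>ev_pole\<close>; for the other, \<open>mon_wt_low_degree\<close> supplies a monomial of
  degree at most t.\<close>

lemma subdegree_span_coords_power:
  "fls_subdegree ` (fls.span (coords ^ t) - {0})
     = uminus ` (pole_semigroup n \<inter> {..int t * int (emb_degree n)})"
proof (intro equalityI subsetI)
  fix d assume "d \<in> fls_subdegree ` (fls.span (coords ^ t) - {0})"
  then obtain u where u: "u \<in> fls.span (coords ^ t)" "u \<noteq> 0" "d = fls_subdegree u"
    by blast
  define M where "M = int t * int (emb_degree n)"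
  \<comment> \<open>Values of polynomials with pole order at most \<open>M\<close>: a subspace that
    contains all t-fold products.\<close>
  define V where "V = {u. \<forall>k < - M. fls_nth u k = 0} \<inter> range ev"
  have V: "fls.subspace V"
  proof (rule fls.subspaceI)
    show "0 \<in> V" by (auto simp: V_def intro!: range_eqI[of _ _ 0] simp: ev_simps)
  next
    fix a b assume "a \<in> V" "b \<in> V"
    thus "a + b \<in> V" by (auto simp: V_def simp flip: eval_fls_add)
  next
    fix c a assume a: "a \<in> V"
    then obtain g where "a = ev g" by (auto simp: V_def)
    hence "fls_const c * a = ev ([:[:c:]:] * g)" by (simp only: ev_simps)
    hence "fls_const c * a \<in> range ev" by (rule range_eqI)
    moreover have "\<forall>k < - M. fls_nth (fls_const c * a) k = 0"
      using a by (simp add: V_def)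
    ultimately show "fls_const c * a \<in> V" by (simp only: V_def Int_iff mem_Collect_eq)
  qed
  have "coords ^ t \<subseteq> V"
  proof
    fix u assume "u \<in> coords ^ t"
    then obtain i a b c where u: "u = x ^ i * y ^ a * z ^ b * w ^ c" "i + a + b + c \<le> t"
      unfolding coords_power by blast
    have "mon_wt n (int i) (int a) (int b) (int c) \<le> int (i + a + b + c) * int (emb_degree n)"
      by (simp add: mon_wt_def emb_degree_def algebra_simps)
    also have "\<dots> \<le> M"
      unfolding M_def using u(2) by (intro mult_right_mono) auto
    finally have "- M \<le> fls_subdegree u"
      by (simp add: u subdegree_mon)
    moreover have "u = ev (mon_fn n i a b c)" by (simp add: u ev_mon)
    ultimately show "u \<in> V" by (auto simp: V_def)
  qed
  hence "u \<in> V" using u(1) V fls.span_minimal by blast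
  then obtain g where g: "u = ev g" and low: "\<And>k. k < - M \<Longrightarrow> fls_nth u k = 0"
    by (auto simp: V_def)
  have "- d \<in> pole_semigroup n"
    using ev_pole[of g] u g by simp
  moreover have "- M \<le> fls_subdegree u"
    using u(2) low by (rule fls_subdegree_geI)
  ultimately show "d \<in> uminus ` (pole_semigroup n \<inter> {..int t * int (emb_degree n)})"
    using u(3) by (intro image_eqI[of _ _ "- d"]) (auto simp: M_def)
next
  fix d assume "d \<in> uminus ` (pole_semigroup n \<inter> {..int t * int (emb_degree n)})"
  then obtain i a b c where d: "d = - mon_wt n (int i) (int a) (int b) (int c)"
    "mon_wt n (int i) (int a) (int b) (int c) \<le> int t * int (emb_degree n)"
    by (auto simp: pole_semigroup_def)
  obtain i' a' b' c' where low: "i' + a' + b' + c' \<le> t"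
    "mon_wt n (int i') (int a') (int b') (int c') = mon_wt n (int i) (int a) (int b) (int c)"
    using mon_wt_low_degree[OF d(2)] by blast
  define u where "u = x ^ i' * y ^ a' * z ^ b' * w ^ c'"
  have "u \<in> coords ^ t" unfolding coords_power u_def using low(1) by blast
  moreover have "u \<noteq> 0" using nonzero by (simp add: u_def)
  moreover have "d = fls_subdegree u" by (simp add: u_def subdegree_mon low d)
  ultimately show "d \<in> fls_subdegree ` (fls.span (coords ^ t) - {0})"
    by (auto intro: fls.span_base)
qed

lemma dim_coords_power_large:
  assumes t: "t \<ge> 2 * q0 n + 1"
  shows "int (fls.dim (fls.span (coords ^ t))) = int t * int (emb_degree n) + 1 - int (genus n)"
proof -
  define M where "M = int t * int (emb_degree n)"
  define S where "S = pole_semigroup n \<inter> {..M}"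
  have "S \<subseteq> {0..M}" using pole_semigroup_nonneg by (auto simp: S_def)
  hence fin: "finite S" by (rule finite_subset) simp
  have "fls.dim (fls.span (coords ^ t)) = card (uminus ` S)"
    using fls_dim_eq_card_subdegree[of "fls.span (coords ^ t)"] fin
    unfolding subdegree_span_coords_power S_def M_def by simp
  also have "\<dots> = card S" by (intro card_image) simp
  finally have dim: "fls.dim (fls.span (coords ^ t)) = card S" .
  \<comment> \<open>This puts \<open>M\<close> in the range where the semigroup count is linear; 2g
    = 2 q0 (q - 1) is below 2 q0 times the embedding degree.\<close>
  have "2 * int (genus n) - 1 \<le> M"
  proof -
    have "2 * genus n \<le> (2 * q0 n + 1) * emb_degree n"
      unfolding genus_def emb_degree_def by (simp add: algebra_simps diff_mult_distrib2)
    also have "\<dots> \<le> t * emb_degree n"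
      using t by (rule mult_right_mono) simp
    finally have "int (2 * genus n) \<le> int (t * emb_degree n)"
      by (rule of_nat_mono)
    thus ?thesis by (simp add: M_def)
  qed
  from card_pole_semigroup_atMost[OF this] show ?thesis
    unfolding dim S_def M_def .
qed

end

theorem theorem5p1:
  fixes n t :: nat and \<phi> :: "nat \<Rightarrow> 'a::field poly poly \<times> 'a poly poly"
  assumes "n \<ge> 2"
    and "CHAR('a) = 2"
    and "card {a::'a. a ^ qq n = a} = qq n"
    and "is_L_basis n \<phi>"
    and "t \<ge> 1"
  shows "(2 \<le> t \<and> t \<le> q0 n \<longrightarrow> kappa n \<phi> t = (t + 2) choose 4) \<and>
         (2 * q0 n + 1 \<le> t \<longrightarrow>
            int (kappa n \<phi> t) = int ((t + 4) choose 4) - int t * int (emb_degree n) - 1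
                                 + int (genus n))"
proof -
  have n: "n \<ge> 1" using assms(1) by simp
  obtain x y z w :: "'a fls" where "suzuki_relations n x y z w"
    "x \<noteq> 0" "y \<noteq> 0" "z \<noteq> 0" "w \<noteq> 0"
    "fls_subdegree x = - int (qq n)" "fls_subdegree y = - int (qq n + q0 n)"
    "fls_subdegree z = - int (qq n + 2 * q0 n)" "fls_subdegree w = - int (qq n + 2 * q0 n + 1)"
    by (rule suzuki_branch_at_infinity[OF assms(2) n])
  then interpret suzuki_branch n x y z w
    using assms(2) n by unfold_locales
  have sum: "kappa n \<phi> t + fls.dim (fls.span (coords ^ t)) = (t + 4) choose 4"
    by (rule kappa_plus_dim[OF assms(4)])
  show ?thesis
  proof (intro conjI impI)
    assume "2 \<le> t \<and> t \<le> q0 n"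
    thus "kappa n \<phi> t = (t + 2) choose 4"
      using sum dim_coords_power_small[OF assms(5)] choose_4_low_degree[of t] by simp
  next
    assume "2 * q0 n + 1 \<le> t"
    hence "int (fls.dim (fls.span (coords ^ t))) = int t * int (emb_degree n) + 1 - int (genus n)"
      by (rule dim_coords_power_large)
    moreover have "int (kappa n \<phi> t) + int (fls.dim (fls.span (coords ^ t))) = int ((t + 4) choose 4)"
      unfolding sum[symmetric] by simp
    ultimately show "int (kappa n \<phi> t) = int ((t + 4) choose 4) - int t * int (emb_degree n) - 1
        + int (genus n)"
      by linarith
  qed
qed

end
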